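(* Let $K\subset\mathbb{R}^n$ be a convex body in Löwner position, and let $f,g:\mathbb{R}\to\mathbb{R}$ satisfy: $f$ is locally Lipschitz, convex, $f(x)=0$ for $x\le-1$, and $f$ is strictly increasing in $[-1,\infty)$; $g$ is locally Lipschitz, non-increasing, $g(x)=1$ for $x\le-1$, $g(x)>0$ for $x\in(-1,1)$, and $g(x)=0$ for $x\ge1$. Then for every $r\in(1/2,1)$ the restriction of $L_r$ to $(\mathrm{Sym}_+\cap\mathrm{SL}_n(\mathbb{R}))\times\mathbb{R}^n$ has a unique minimum $(A_r,v_r)$, and $\lim_{r\to1^-}(A_r,v_r)=(\mathrm{Id},0)$. Likewise, the restriction of $I_r$ to $$\left(\frac{(\mathrm{SL}_n(\mathbb{R})\cap\mathrm{Sym}_+)-\mathrm{Id}}{1-r}\right)\times\mathbb{R}^n$$ has the unique minimum $(M_r,w_r)=\left(\frac{A_r-\mathrm{Id}}{1-r},\frac{v_r}{1-r}\right)$, and $\mathrm{tr}\left(\frac{M_r}{\|M_r\|_F}\right)\to0$ as $r\to1^-$ (where $\frac{M_r}{\|M_r\|_F}$ is interpreted as $0$ when $M_r=0$).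
   Context: A convex body is a compact convex subset of $\mathbb{R}^n$ with non-empty interior. $\mathbb{B}$ is the closed unit Euclidean ball. A convex body $K$ is in Löwner position if $\mathbb{B}$ is the (unique) ellipsoid of minimal volume containing $K$; in that case $0$ is in the interior of $K$. $|x|_2$ is the Euclidean norm and $\|x\|_K=\inf\{\lambda>0: x\in\lambda K\}$ the gauge function of $K$. $\mathrm{M}_n(\mathbb{R})$ is the space of real $n\times n$ matrices, $\mathrm{Sym}$ and $\mathrm{Sym}_+$ are the sets of symmetric and of symmetric positive-definite matrices, $\mathrm{SL}_n(\mathbb{R})$ is the set of matrices of determinant one, and $\|A\|_F=\sqrt{\mathrm{tr}(A^TA)}$. For $r\in(1/2,1)$ and $h:\mathbb{R}\to\mathbb{R}$ put $h_r(s)=h\left(\frac{s-1}{1-r}\right)$. The functional $L_r:\mathrm{M}_n(\mathbb{R})\times\mathbb{R}^n\to\mathbb{R}$ is $$L_r(A,v)=\frac1{1-r}\int_{\mathbb{R}^n}f_r(|Ax+v|_2)\,g_r(\|x\|_K)\,dx.$$ Let $B_r=\{M\in\mathrm{Sym}:\mathrm{Id}+(1-r)M\text{ is invertible}\}$. The functional $I_r:B_r\times\mathbb{R}^n\to\mathbb{R}$ is $$I_r(M,w)=\frac1{1-r}\int_{\mathbb{R}^n}f_r(|x|_2)\,g_r\!\left(\left\|(\mathrm{Id}+(1-r)M)^{-1}(x-(1-r)w)\right\|_K\right)dx.$$ *)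

theory Defs
  imports "HOL-Analysis.Analysis"
begin

definition convex_body :: "(real^'n) set \<Rightarrow> bool" where
  "convex_body K \<longleftrightarrow> compact K \<and> convex K \<and> interior K \<noteq> {}"

definition ellipsoid :: "(real^'n) set \<Rightarrow> bool" where
  "ellipsoid E \<longleftrightarrow> (\<exists>(T::real^'n^'n) c. invertible T \<and> E = (\<lambda>x. T *v x + c) ` cball 0 1)"

definition unique_minimum_on :: "('a \<Rightarrow> real) \<Rightarrow> 'a set \<Rightarrow> 'a \<Rightarrow> bool" where
  "unique_minimum_on F S p \<longleftrightarrow>
     is_arg_min F (\<lambda>x. x \<in> S) p \<and> (\<forall>q. is_arg_min F (\<lambda>x. x \<in> S) q \<longrightarrow> q = p)"

definition loewner_position :: "(real^'n) set \<Rightarrow> bool" where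
  "loewner_position K \<longleftrightarrow>
     unique_minimum_on (measure lebesgue) {E. ellipsoid E \<and> K \<subseteq> E} (cball 0 1)"

definition gauge_function :: "(real^'n) set \<Rightarrow> real^'n \<Rightarrow> real" where
  "gauge_function K x = Inf {l. 0 < l \<and> x \<in> (\<lambda>y. l *\<^sub>R y) ` K}"

definition locally_lipschitz :: "(real \<Rightarrow> real) \<Rightarrow> bool" where
  "locally_lipschitz h \<longleftrightarrow> (\<forall>x. \<exists>e>0. \<exists>C. C-lipschitz_on (cball x e) h)"

definition Sym :: "(real^'n^'n) set" where
  "Sym = {A. transpose A = A}"

definition Sym_pos :: "(real^'n^'n) set" where
  "Sym_pos = {A \<in> Sym. \<forall>x. x \<noteq> 0 \<longrightarrow> 0 < x \<bullet> (A *v x)}"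

definition SL :: "(real^'n^'n) set" where
  "SL = {A. det A = 1}"

definition frobenius_norm :: "real^'n^'n \<Rightarrow> real" where
  "frobenius_norm A = sqrt (trace (transpose A ** A))"

definition rescale :: "real \<Rightarrow> (real \<Rightarrow> real) \<Rightarrow> real \<Rightarrow> real" where
  "rescale r h s = h ((s - 1) / (1 - r))"

definition L_functional ::
    "(real^'n) set \<Rightarrow> (real \<Rightarrow> real) \<Rightarrow> (real \<Rightarrow> real) \<Rightarrow> real \<Rightarrow> (real^'n^'n) \<times> (real^'n) \<Rightarrow> real" where
  "L_functional K f g r = (\<lambda>(A, v).
     1 / (1 - r) *
       (LINT x|lebesgue. rescale r f (norm (A *v x + v)) * rescale r g (gauge_function K x)))"

definition I_domain :: "real \<Rightarrow> (real^'n^'n) set" where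
  "I_domain r = {M \<in> Sym. invertible (mat 1 + (1 - r) *\<^sub>R M)}"

text \<open>Only the values of \<open>I_functional K f g r\<close> on \<open>I_domain r \<times> UNIV\<close> are meaningful,
  since \<open>matrix_inv\<close> is unspecified on singular matrices.\<close>

definition I_functional ::
    "(real^'n) set \<Rightarrow> (real \<Rightarrow> real) \<Rightarrow> (real \<Rightarrow> real) \<Rightarrow> real \<Rightarrow> (real^'n^'n) \<times> (real^'n) \<Rightarrow> real" where
  "I_functional K f g r = (\<lambda>(M, w).
     1 / (1 - r) *
       (LINT x|lebesgue. rescale r f (norm x) *
          rescale r g (gauge_function K
            (matrix_inv (mat 1 + (1 - r) *\<^sub>R M) *v (x - (1 - r) *\<^sub>R w)))))"

definition rescaled_SL_Sym_pos :: "real \<Rightarrow> (real^'n^'n) set" where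
  "rescaled_SL_Sym_pos r = (\<lambda>A. (1 / (1 - r)) *\<^sub>R (A - mat 1)) ` (SL \<inter> Sym_pos)"

lemma rescaled_SL_Sym_pos_subset:
  assumes "r \<noteq> 1"
  shows "(rescaled_SL_Sym_pos r :: (real^'n^'n) set) \<subseteq> I_domain r"
proof
  fix M :: "real^'n^'n"
  assume "M \<in> rescaled_SL_Sym_pos r"
  then obtain A where A: "A \<in> SL" "A \<in> Sym_pos" and M: "M = (1 / (1 - r)) *\<^sub>R (A - mat 1)"
    by (auto simp: rescaled_SL_Sym_pos_def)
  have "mat 1 + (1 - r) *\<^sub>R M = A"
    using assms by (simp add: M)
  moreover have "invertible A"
    using A by (simp add: SL_def invertible_det_nz)
  moreover have "A $ i $ j = A $ j $ i" for i j
    using A by (auto simp: Sym_pos_def Sym_def transpose_def vec_eq_iff)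
  then have "M \<in> Sym"
    by (simp add: M Sym_def transpose_def vec_eq_iff mat_def)
  ultimately show "M \<in> I_domain r"
    by (simp add: I_domain_def)
qed

end

theory Submission imports Defs begin

text \<open>
  Write \<open>\<phi> y = f\<^sub>r |y|\<close> and let \<open>\<omega>\<close> be the weight \<open>x \<mapsto> g\<^sub>r (gauge of K at x)\<close>.  Up to the factor
  \<open>1 / (1 - r)\<close>, the functional is the energy \<open>E (A, v) = \<integral> \<phi> (A x + v) \<omega> x dx\<close>.  The function \<open>\<phi>\<close> is
  convex, vanishes exactly on the ball of radius \<open>r\<close> and increases with the norm outside it; the weight is
  \<open>1\<close> on \<open>r K\<close>, positive inside \<open>(2 - r) K\<close> and \<open>0\<close> outside it.  That it vanishes outside
  \<open>(2 - r) K\<close>, and the coercivity below, rest on \<open>0\<close> lying in the interior of \<open>K\<close>; this holds because a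
  half ball fits into an ellipsoid of volume smaller than that of the ball (\<open>loewner_0_in_interior\<close>).

  \<^bold>\<open>Existence.\<close>  Convexity of \<open>f\<close> makes it grow at least linearly, so the energy dominates a multiple of
  \<open>G\<^sub>\<rho> (A, v) = \<integral> max 0 (|A x + v| - 1) dx\<close>, taken over \<open>\<rho> K\<close> for any \<open>\<rho> \<le> r\<close>.  That function is
  coercive, and the matrices in question form a closed set (\<open>closed_Sym_pos_SL\<close>).

  \<^bold>\<open>Uniqueness.\<close>  The energy is convex, but the matrices of determinant one are not a convex set.  If two
  minimizers have different matrices, the midpoint matrix has determinant greater than one
  (\<open>det_midpoint_gt_1\<close>); scaling it back to determinant one strictly lowers the energy unless its image of
  \<open>(2 - r) K\<close> lies in the ball of radius \<open>r\<close>, and that would put \<open>K\<close> into an ellipsoid of volume less than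
  that of the unit ball.  If the matrices agree and the translations differ by \<open>2 d\<close>, then \<open>\<phi>\<close> satisfies
  the midpoint equality on the whole midpoint image \<open>W\<close> of \<open>(2 - r) K\<close>.  This image meets the sphere
  of radius \<open>r\<close>: it leaves the ball by the volume argument, and it enters the ball since otherwise a
  translation along the normal of a separating hyperplane would lower the energy.  At a point \<open>w\<close> of the
  sphere, \<open>\<phi> w = 0\<close> forces \<open>\<phi> (w + d) = \<phi> (w - d) = 0\<close>, and the parallelogram law gives \<open>d = 0\<close>.

  \<^bold>\<open>Limit.\<close>  The energy of the identity stays bounded as \<open>r\<close> tends to \<open>1\<close>, so
  \<open>G\<^sub>\<rho>\<close> at the minimizer is \<open>O(1 - r)\<close>.  The minimizers therefore stay bounded, and \<open>G\<^sub>\<rho>\<close>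
  vanishes at any accumulation point for every \<open>\<rho> < 1\<close>, which means that this affine map sends \<open>K\<close> into
  the unit ball.  Uniqueness of the Loewner ellipsoid leaves only the identity.

  \<^bold>\<open>The second functional and the trace.\<close>  The substitution \<open>x \<mapsto> A x + v\<close> with \<open>det A = 1\<close> identifies both
  functionals.  Finally, the derivative of \<open>det\<close> at the identity is the trace, so \<open>det A\<^sub>r = 1\<close>
  makes the trace of \<open>A\<^sub>r - Id\<close> negligible against its norm.
\<close>

section \<open>Linear images and Lebesgue measure\<close>

lemma det_shear:
  fixes m n :: "'n::finite"
  assumes "m \<noteq> n"
  shows "det (matrix (\<lambda>x::real^'n. \<chi> i. if i = m then x $ m + x $ n else x $ i)) = 1"
proof -
  have "matrix (\<lambda>x::real^'n. \<chi> i. if i = m then x $ m + x $ n else x $ i)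
      = (\<chi> k. if k = m then row m (mat 1) + 1 *s row n (mat 1) else row k (mat 1))"
    by (auto simp: matrix_def row_def mat_def axis_def vec_eq_iff)
  then show ?thesis
    using det_row_operation[OF assms, of "mat 1 :: real^'n^'n" 1] by simp
qed

lemma det_swap:
  fixes m n :: "'n::finite"
  shows "\<bar>det (matrix (\<lambda>x::real^'n. \<chi> i. x $ Transposition.transpose m n i))\<bar> = 1"
proof -
  have "matrix (\<lambda>x::real^'n. \<chi> i. x $ Transposition.transpose m n i)
      = (\<chi> i. mat 1 $ Transposition.transpose m n i)"
    by (auto simp: matrix_def mat_def axis_def vec_eq_iff)
  then show ?thesis
    by (simp add: det_permute_rows permutes_swap_id sign_swap_id)
qed

text \<open>Volumes scale by the determinant.  Every linear map is a product of elementary ones, and for these it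
  suffices to look at boxes.  The determinant of a shear is read off as a row operation, so that
  the indices need not be ordered.\<close>
lemma measure_linear_image_finite:
  fixes f :: "real^'n \<Rightarrow> real^'n"
  assumes "linear f" "S \<in> lmeasurable"
  shows "f ` S \<in> lmeasurable \<and> measure lebesgue (f ` S) = \<bar>det (matrix f)\<bar> * measure lebesgue S"
proof -
  have "\<forall>S\<in>lmeasurable. f ` S \<in> lmeasurable \<and>
          measure lebesgue (f ` S) = \<bar>det (matrix f)\<bar> * measure lebesgue S"
  proof (rule induct_linear_elementary[OF assms(1)]; intro ballI)
    fix f g :: "real^'n \<Rightarrow> real^'n" and S :: "(real^'n) set"
    assume "linear f" "linear g" "S \<in> lmeasurable"
      "\<forall>S\<in>lmeasurable. f ` S \<in> lmeasurable \<and> measure lebesgue (f ` S) = \<bar>det (matrix f)\<bar> * measure lebesgue S"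
      "\<forall>S\<in>lmeasurable. g ` S \<in> lmeasurable \<and> measure lebesgue (g ` S) = \<bar>det (matrix g)\<bar> * measure lebesgue S"
    then show "(f \<circ> g) ` S \<in> lmeasurable \<and>
        measure lebesgue ((f \<circ> g) ` S) = \<bar>det (matrix (f \<circ> g))\<bar> * measure lebesgue S"
      unfolding image_comp[symmetric] by (simp del: image_comp add: matrix_compose abs_mult det_mul)
  next
    fix f :: "real^'n \<Rightarrow> real^'n" and i and S :: "(real^'n) set"
    assume f: "linear f" "\<And>x. f x $ i = 0" and S: "S \<in> lmeasurable"
    then have "\<not> surj f"
      by (metis axis_nth one_neq_zero surjD)
    then have inj: "\<not> inj f"
      using f(1) linear_injective_imp_surjective by blast
    then have neg: "negligible (f ` S)"
      using f(1) negligible_linear_singular_image by blast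
    then show "f ` S \<in> lmeasurable \<and> measure lebesgue (f ` S) = \<bar>det (matrix f)\<bar> * measure lebesgue S"
      using inj det_nz_iff_inj[OF f(1)] by (simp add: negligible_imp_measurable negligible_imp_measure0)
  next
    fix c :: "'n \<Rightarrow> real" and S :: "(real^'n) set"
    assume S: "S \<in> lmeasurable"
    have "det (matrix (\<lambda>x::real^'n. \<chi> i. c i * x $ i)) = prod c UNIV"
      by (subst det_diagonal) (auto simp: matrix_def axis_def)
    then show "(\<lambda>x. \<chi> i. c i * x $ i) ` S \<in> lmeasurable \<and>
        measure lebesgue ((\<lambda>x. \<chi> i. c i * x $ i) ` S)
          = \<bar>det (matrix (\<lambda>x. \<chi> i. c i * x $ i))\<bar> * measure lebesgue S"
      using measurable_stretch[OF S] measure_stretch[OF S] by simp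
  next
    fix m n :: 'n and S :: "(real^'n) set"
    assume "m \<noteq> n" and S: "S \<in> lmeasurable"
    let ?h = "\<lambda>x::real^'n. \<chi> i. x $ Transposition.transpose m n i"
    have lin: "linear ?h"
      by (rule linearI) (simp_all add: vec_eq_iff)
    have box: "?h ` cbox a b = cbox (?h a) (?h b)" for a b
      by (auto simp: image_iff lambda_swap_Galois mem_box_cart) (metis transpose_involutory)+
    have "measure lebesgue (?h ` cbox a b) = measure lebesgue (cbox a b)" for a b
    proof (cases "cbox a b = {}")
      case False
      then have "cbox (?h a) (?h b) \<noteq> {}"
        unfolding box[symmetric] by blast
      then show ?thesis
        unfolding box
        using prod.permute[OF permutes_swap_id, where S=UNIV and g="\<lambda>i. (b - a) $ i", symmetric] False
        by (simp add: content_cbox_cart o_def)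
    qed simp
    then show "?h ` S \<in> lmeasurable \<and> measure lebesgue (?h ` S) = \<bar>det (matrix ?h)\<bar> * measure lebesgue S"
      using measure_linear_sufficient[OF lin S, of 1] by (simp add: det_swap)
  next
    fix m n :: 'n and S :: "(real^'n) set"
    assume mn: "m \<noteq> n" and S: "S \<in> lmeasurable"
    let ?h = "\<lambda>x::real^'n. \<chi> i. if i = m then x $ m + x $ n else x $ i"
    have lin: "linear ?h"
      by (rule linearI) (auto simp: vec_eq_iff algebra_simps)
    have "measure lebesgue (?h ` cbox a b) = measure lebesgue (cbox a b)" for a b
    proof (cases "cbox a b = {}")
      case False
      \<comment> \<open>Translate the box so that its \<open>n\<close>-th lower bound becomes \<open>0\<close>: \<open>measure_shear_interval\<close> asks for a nonnegative one.\<close>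
      define v :: "real^'n" where "v = (\<chi> i. if i = n then - a $ n else 0)"
      have "cbox a b = (+) (- v) ` cbox (v + a) (v + b)"
        by (simp only: cbox_translation[symmetric]) (simp add: image_comp o_def)
      moreover have "?h ` (+) (- v) ` X = (+) (?h (- v)) ` ?h ` X" for X
        by (simp only: image_image linear_add[OF lin])
      moreover have "measure lebesgue (?h ` cbox (v + a) (v + b)) = measure lebesgue (cbox (v + a) (v + b))"
        using False mn by (intro measure_shear_interval) (auto simp: v_def box_ne_empty(1) cbox_translation)
      ultimately show ?thesis
        by (simp only: measure_translation)
    qed simp
    then show "?h ` S \<in> lmeasurable \<and> measure lebesgue (?h ` S) = \<bar>det (matrix ?h)\<bar> * measure lebesgue S"
      using measure_linear_sufficient[OF lin S, of 1] by (simp add: det_shear[OF mn])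
  qed
  then show ?thesis
    using assms(2) by blast
qed

section \<open>Positive definite matrices of determinant one\<close>

lemma Sym_posD:
  assumes "A \<in> Sym_pos"
  shows "transpose A = A" "x \<noteq> 0 \<Longrightarrow> 0 < x \<bullet> (A *v x)" "0 \<le> x \<bullet> (A *v x)"
  using assms by (cases "x = 0"; force simp: Sym_pos_def Sym_def)+

lemma inner_symmetric_matrix:
  fixes A :: "real^'n^'n"
  assumes "transpose A = A"
  shows "x \<bullet> (A *v y) = y \<bullet> (A *v x)"
  by (metis assms dot_lmul_matrix inner_commute transpose_matrix_vector)

lemma mat_1_Sym_pos [simp]: "mat 1 \<in> (Sym_pos :: (real^'n^'n) set)"
  by (simp add: Sym_pos_def Sym_def)

text \<open>The matrices all of whose rows lie in the ellipsoid \<open>x \<bullet> A x \<le> 1\<close>.  Maximizing the determinant over them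
  replaces the spectral theorem: a maximizer has \<open>A\<close>-orthonormal rows.\<close>
definition row_ellipsoid :: "real^'n^'n \<Rightarrow> (real^'n^'n) set" where
  "row_ellipsoid A = {D. \<forall>i. D $ i \<bullet> (A *v D $ i) \<le> 1}"

definition row_replace :: "real^'n^'n \<Rightarrow> 'n \<Rightarrow> real^'n \<Rightarrow> real^'n^'n" where
  "row_replace D i y = (\<chi> k. if k = i then y else D $ k)"

lemma det_row_replace_scaleR: "det (row_replace D i (c *\<^sub>R y)) = c * det (row_replace D i y)"
  using det_row_mul[of i c "\<lambda>_. y" "\<lambda>k. D $ k"]
  by (simp add: row_replace_def flip: scalar_mult_eq_scaleR)

lemma det_row_replace_add:
  fixes D :: "real^'n^'n"
  assumes "i \<noteq> j"
  shows "det (row_replace D i (D $ i + c *\<^sub>R D $ j)) = det D"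
proof -
  have "row_replace D i (D $ i + c *\<^sub>R D $ j) = (\<chi> k. if k = i then row i D + c *s row j D else row k D)"
    by (simp add: row_replace_def row_def scalar_mult_eq_scaleR vec_eq_iff)
  then show ?thesis
    using det_row_operation[OF assms] by simp
qed

text \<open>Row operations keep the determinant, and rescaling a row \<open>y\<close> to \<open>A\<close>-length one divides it by that
  length.  Hence at a maximizer no row can be replaced, with the same determinant, by a vector of \<open>A\<close>-length
  below one.  Applied to a row this gives length one; applied to a row minus its \<open>A\<close>-projection to
  another row it gives orthogonality.\<close>
lemma maximal_row_ellipsoid_orthonormal:
  fixes A D :: "real^'n^'n"
  assumes A: "A \<in> Sym_pos" and D: "D \<in> row_ellipsoid A" and pos: "0 < det D"
    and max: "\<And>D'. D' \<in> row_ellipsoid A \<Longrightarrow> det D' \<le> det D"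
  shows "D ** A ** transpose D = mat 1"
proof -
  have key: "1 \<le> y \<bullet> (A *v y)" if y: "det (row_replace D i y) = det D" for i y
  proof -
    let ?q = "y \<bullet> (A *v y)"
    have "row_replace D i (0::real^'n) = row_replace D i (0 *\<^sub>R 0)"
      by simp
    then have "y \<noteq> 0"
      using y pos det_row_replace_scaleR[of D i 0 0] by force
    then have q: "0 < ?q"
      using Sym_posD(2)[OF A] by blast
    have "row_replace D i ((1 / sqrt ?q) *\<^sub>R y) \<in> row_ellipsoid A"
      using D q by (auto simp: row_ellipsoid_def row_replace_def matrix_vector_mult_scaleR
            simp flip: power2_eq_square)
    then have "det D / sqrt ?q \<le> det D"
      using max[of "row_replace D i ((1 / sqrt ?q) *\<^sub>R y)"] y by (simp add: det_row_replace_scaleR)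
    then show ?thesis
      using q pos by (simp add: divide_le_eq)
  qed
  have diag: "D $ i \<bullet> (A *v D $ i) = 1" for i
  proof (rule antisym)
    show "D $ i \<bullet> (A *v D $ i) \<le> 1"
      using D by (simp add: row_ellipsoid_def)
    have "row_replace D i (D $ i) = D"
      by (simp add: row_replace_def vec_eq_iff)
    then show "1 \<le> D $ i \<bullet> (A *v D $ i)"
      using key[of i] by simp
  qed
  have off: "D $ i \<bullet> (A *v D $ j) = 0" if "i \<noteq> j" for i j
  proof -
    define b where "b = D $ i \<bullet> (A *v D $ j)"
    have "1 \<le> (D $ i + (- b) *\<^sub>R D $ j) \<bullet> (A *v (D $ i + (- b) *\<^sub>R D $ j))"
      using key det_row_replace_add[OF that] by blast
    also have "\<dots> = 1 - b\<^sup>2"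
      using diag[of i] diag[of j] inner_symmetric_matrix[OF Sym_posD(1)[OF A], of "D $ i" "D $ j"]
      by (simp add: algebra_simps matrix_vector_right_distrib matrix_vector_mult_diff_distrib
          matrix_vector_mult_scaleR b_def power2_eq_square)
    finally show ?thesis
      by (simp add: b_def)
  qed
  have entry: "(D ** A ** transpose D) $ i $ j = D $ i \<bullet> (A *v D $ j)" for i j
    unfolding matrix_mul_assoc[symmetric]
    by (simp add: matrix_matrix_mult_def matrix_vector_mult_def transpose_def inner_vec_def)
  show ?thesis
    using diag off by (simp add: vec_eq_iff entry mat_def)
qed

lemma Sym_pos_coercive:
  fixes A :: "real^'n^'n"
  assumes "A \<in> Sym_pos"
  obtains c where "0 < c" "\<And>x. c * (norm x)\<^sup>2 \<le> x \<bullet> (A *v x)"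
proof -
  have "continuous_on (sphere 0 1) (\<lambda>x. x \<bullet> (A *v x))"
    by (intro continuous_intros)
  then obtain z where z: "z \<in> sphere 0 1" "\<And>x. x \<in> sphere 0 1 \<Longrightarrow> z \<bullet> (A *v z) \<le> x \<bullet> (A *v x)"
    using continuous_attains_inf[of "sphere (0::real^'n) 1" "\<lambda>x. x \<bullet> (A *v x)"] by auto
  show ?thesis
  proof
    show "0 < z \<bullet> (A *v z)"
      using z(1) Sym_posD(2)[OF assms, of z] by force
    show "z \<bullet> (A *v z) * (norm x)\<^sup>2 \<le> x \<bullet> (A *v x)" for x
    proof (cases "x = 0")
      case False
      then have "z \<bullet> (A *v z) \<le> sgn x \<bullet> (A *v sgn x)"
        by (intro z(2)) (simp add: norm_sgn)
      then show ?thesis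
        using False by (simp add: sgn_div_norm matrix_vector_mult_scaleR field_simps power2_eq_square)
    qed simp
  qed
qed

lemma compact_row_ellipsoid:
  fixes A :: "real^'n^'n"
  assumes "A \<in> Sym_pos"
  shows "compact (row_ellipsoid A)"
proof -
  obtain c where c: "0 < c" "\<And>x. c * (norm x)\<^sup>2 \<le> x \<bullet> (A *v x)"
    using Sym_pos_coercive[OF assms] by blast
  have "norm D \<le> (\<Sum>i\<in>(UNIV::'n set). sqrt (1 / c))" if D: "D \<in> row_ellipsoid A" for D
  proof -
    have "norm (D $ i) \<le> sqrt (1 / c)" for i
    proof (rule real_le_rsqrt)
      have "c * (norm (D $ i))\<^sup>2 \<le> 1"
        using order_trans[OF c(2)[of "D $ i"]] D by (simp add: row_ellipsoid_def)
      then show "(norm (D $ i))\<^sup>2 \<le> 1 / c"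
        using c(1) by (simp add: field_simps)
    qed
    moreover have "norm D \<le> (\<Sum>i\<in>UNIV. norm (D $ i))"
      unfolding norm_vec_def by (rule L2_set_le_sum) simp
    ultimately show ?thesis
      by (meson order_trans sum_mono)
  qed
  then have "bounded (row_ellipsoid A)"
    by (auto simp: bounded_iff)
  moreover have "closed (row_ellipsoid A)"
    unfolding row_ellipsoid_def by (intro closed_Collect_all closed_Collect_le continuous_intros
        bounded_linear.continuous_on[OF matrix_vector_mul_bounded_linear])
  ultimately show ?thesis
    by (simp add: compact_eq_bounded_closed)
qed

lemma Sym_pos_diagonal:
  fixes A :: "real^'n^'n"
  assumes "A \<in> Sym_pos"
  shows "0 < A $ i $ i"
proof -
  have "axis i (1::real) \<noteq> 0"
    by (simp add: axis_eq_0_iff)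
  then have "0 < axis i 1 \<bullet> (A *v axis i 1)"
    using Sym_posD(2)[OF assms] by blast
  then show ?thesis
    by (simp add: inner_axis' matrix_vector_mult_basis column_def)
qed

text \<open>This competitor carries Hadamard's inequality: comparing its determinant with the maximum bounds
  \<open>det A\<close> by the product of the diagonal entries.\<close>
lemma diagonal_in_row_ellipsoid:
  fixes A :: "real^'n^'n"
  assumes "A \<in> Sym_pos"
  shows "(\<chi> i j. if i = j then 1 / sqrt (A $ i $ i) else 0) \<in> row_ellipsoid A"
proof -
  have "(\<chi> j. if i = j then 1 / sqrt (A $ i $ i) else 0) = (1 / sqrt (A $ i $ i)) *\<^sub>R axis i 1" for i
    by (simp add: vec_eq_iff axis_def)
  moreover have "axis i 1 \<bullet> (A *v axis i 1) = A $ i $ i" for i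
    by (simp add: inner_axis' matrix_vector_mult_basis column_def)
  ultimately show ?thesis
    using Sym_pos_diagonal[OF assms]
    by (simp add: row_ellipsoid_def matrix_vector_mult_scaleR less_imp_le)
qed

text \<open>A square root of the inverse of \<open>A\<close>, up to an orthogonal factor, together with its extremal property.\<close>
lemma Sym_pos_orthonormalize:
  fixes A :: "real^'n^'n"
  assumes A: "A \<in> Sym_pos"
  obtains C where "0 < det C" "C ** A ** transpose C = mat 1"
    "\<And>D. D \<in> row_ellipsoid A \<Longrightarrow> det D \<le> det C"
proof -
  have ne: "row_ellipsoid A \<noteq> {}"
    by (auto simp: row_ellipsoid_def intro!: exI[of _ 0])
  have cont: "continuous_on (row_ellipsoid A) (det :: real^'n^'n \<Rightarrow> real)"
    unfolding det_def[abs_def] by (intro continuous_intros)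
  obtain C where C: "C \<in> row_ellipsoid A" "\<And>D. D \<in> row_ellipsoid A \<Longrightarrow> det D \<le> det C"
    using continuous_attains_sup[OF compact_row_ellipsoid[OF A] ne cont] by auto
  have "(\<chi> i j. if i = j then 1 / sqrt (A $ i $ i) else 0) \<in> row_ellipsoid A"
    using diagonal_in_row_ellipsoid[OF A] .
  moreover have "0 < det (\<chi> i j. if i = j then 1 / sqrt (A $ i $ i) else 0 :: real^'n^'n)"
    using Sym_pos_diagonal[OF A] by (subst det_diagonal) (auto intro!: prod_pos)
  ultimately have "0 < det C"
    using C(2) by force
  then show ?thesis
    using that C maximal_row_ellipsoid_orthonormal[OF A] by blast
qed

text \<open>The equality case of the arithmetic-geometric mean inequality for eigenvalues, without eigenvalues.
  By \<open>ln x \<le> x - 1\<close> the diagonal matrix with entries \<open>1 / sqrt (A $ i $ i)\<close> has determinant at least one,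
  whereas no determinant in \<open>row_ellipsoid A\<close> exceeds one.  So it is a maximizer and \<open>A\<close> is diagonal; then
  equality in \<open>ln x \<le> x - 1\<close> makes the diagonal entries one.\<close>
lemma trace_le_imp_eq_mat_1:
  fixes A :: "real^'n^'n"
  assumes A: "A \<in> Sym_pos" and det: "1 \<le> det A" and tr: "trace A \<le> CARD('n)"
  shows "A = mat 1"
proof -
  let ?D = "(\<chi> i j. if i = j then 1 / sqrt (A $ i $ i) else 0) :: real^'n^'n"
  note pos = Sym_pos_diagonal[OF A]
  obtain C where C: "0 < det C" "C ** A ** transpose C = mat 1"
    "\<And>D. D \<in> row_ellipsoid A \<Longrightarrow> det D \<le> det C"
    using Sym_pos_orthonormalize[OF A] by blast
  have "(det C)\<^sup>2 * det A = 1"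
    using arg_cong[OF C(2), of det] by (simp add: det_mul power2_eq_square mult.commute mult.left_commute)
  then have "(det C)\<^sup>2 \<le> 1"
    using mult_left_mono[OF det, of "(det C)\<^sup>2"] by simp
  then have C1: "det C \<le> 1"
    using power2_le_imp_le[of "det C" 1] by simp
  have detD: "det ?D = (\<Prod>i\<in>UNIV. 1 / sqrt (A $ i $ i))"
    by (subst det_diagonal) auto
  have "(\<Sum>i\<in>UNIV. ln (A $ i $ i)) \<le> (\<Sum>i\<in>UNIV. A $ i $ i - 1)"
    using pos by (intro sum_mono) (simp add: ln_le_minus_one)
  also have "\<dots> \<le> 0"
    using tr by (simp add: sum_subtractf trace_def)
  finally have ln_sum: "(\<Sum>i\<in>UNIV. ln (A $ i $ i)) \<le> 0" .
  have "ln (det ?D) = - (\<Sum>i\<in>UNIV. ln (A $ i $ i)) / 2"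
  proof -
    have "ln (1 / sqrt (A $ i $ i)) = - (ln (A $ i $ i) / 2)" for i
      using pos[of i] by (simp add: ln_div ln_sqrt)
    moreover have "1 / sqrt (A $ i $ i) \<noteq> 0" for i
      using pos[of i] by simp
    ultimately show ?thesis
      unfolding detD using pos by (simp add: ln_prod sum_negf sum_divide_distrib)
  qed
  moreover have "0 < det ?D"
    unfolding detD using pos by (intro prod_pos) auto
  ultimately have D1: "1 \<le> det ?D"
    using ln_sum ln_ge_zero_iff[of "det ?D"] by linarith
  \<comment> \<open>As \<open>det C\<close> is the maximum and at most one, \<open>?D\<close> attains it.\<close>
  then have Deq: "?D ** A ** transpose ?D = mat 1"
    using diagonal_in_row_ellipsoid[OF A] C(3) C1 by (intro maximal_row_ellipsoid_orthonormal[OF A]) force+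
  have off: "A $ i $ j = 0" if "i \<noteq> j" for i j
  proof -
    have "(?D ** A ** transpose ?D) $ i $ j = A $ i $ j / (sqrt (A $ i $ i) * sqrt (A $ j $ j))"
      by (simp add: matrix_matrix_mult_def transpose_def if_distrib[of "\<lambda>x. x * _"]
          if_distrib[of "\<lambda>x. _ * x"] cong: if_cong)
    then show ?thesis
      using that pos[of i] pos[of j] by (simp add: Deq mat_def)
  qed
  have "prod (\<lambda>i. A $ i $ i) UNIV = det A"
    using off by (simp add: det_diagonal)
  then have "0 \<le> ln (prod (\<lambda>i. A $ i $ i) UNIV)"
    using det by simp
  also have "\<dots> = (\<Sum>i\<in>UNIV. ln (A $ i $ i))"
    using pos less_imp_neq[OF pos, symmetric] by (simp add: ln_prod)
  finally have "(\<Sum>i\<in>UNIV. A $ i $ i - 1 - ln (A $ i $ i)) \<le> 0"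
    using tr by (simp add: sum_subtractf trace_def)
  moreover have nn: "0 \<le> A $ i $ i - 1 - ln (A $ i $ i)" for i
    using ln_le_minus_one[OF pos[of i]] by simp
  ultimately have "A $ i $ i - 1 - ln (A $ i $ i) = 0" for i
    using sum_nonneg_eq_0_iff[of UNIV "\<lambda>i. A $ i $ i - 1 - ln (A $ i $ i)"]
    by (smt (verit) UNIV_I finite sum_nonneg)
  then have "A $ i $ i = 1" for i
    using ln_eq_minus_one[OF pos[of i]] by simp
  then show ?thesis
    using off by (simp add: vec_eq_iff mat_def)
qed

lemma Sym_pos_congruence:
  fixes A C :: "real^'n^'n"
  assumes A: "A \<in> Sym_pos" and C: "det C \<noteq> 0"
  shows "C ** A ** transpose C \<in> Sym_pos"
proof -
  have "transpose (C ** A ** transpose C) = C ** A ** transpose C"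
    using Sym_posD(1)[OF A] by (simp add: matrix_transpose_mul matrix_mul_assoc)
  moreover have "0 < x \<bullet> ((C ** A ** transpose C) *v x)" if "x \<noteq> 0" for x
  proof -
    have "transpose C *v x \<noteq> 0"
      using that C by (metis invertible_det_nz invertible_left_inverse matrix_left_invertible_ker det_transpose)
    moreover have "x \<bullet> ((C ** A ** transpose C) *v x) = (transpose C *v x) \<bullet> (A *v (transpose C *v x))"
      by (simp add: matrix_vector_mul_assoc[symmetric] dot_lmul_matrix del: matrix_vector_mul_assoc)
    ultimately show ?thesis
      using Sym_posD(2)[OF A] by simp
  qed
  ultimately show ?thesis
    by (simp add: Sym_pos_def Sym_def)
qed

lemma matrix_add_rdistrib: "(A + B) ** C = A ** C + B ** (C :: real^'n^'n)"
  by (simp add: matrix_matrix_mult_def vec_eq_iff algebra_simps sum.distrib)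

lemma Sym_pos_add: "A \<in> Sym_pos \<Longrightarrow> B \<in> Sym_pos \<Longrightarrow> A + B \<in> (Sym_pos :: (real^'n^'n) set)"
  by (auto simp: Sym_pos_def Sym_def transpose_def vec_eq_iff matrix_vector_mult_add_rdistrib
      inner_add_right add_pos_pos)

lemma Sym_pos_scaleR: "A \<in> Sym_pos \<Longrightarrow> 0 < c \<Longrightarrow> c *\<^sub>R A \<in> (Sym_pos :: (real^'n^'n) set)"
  by (auto simp: Sym_pos_def Sym_def transpose_def vec_eq_iff scaleR_matrix_vector_assoc[symmetric])

lemma det_scaleR: "det (c *\<^sub>R A) = c ^ CARD('n) * det (A :: real^'n^'n)"
proof -
  have "c *\<^sub>R A = (\<chi> i. c *s A $ i)"
    by (simp add: vec_eq_iff)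
  then show ?thesis
    by (simp add: det_rows_mul)
qed

text \<open>Strict log-concavity of the determinant.  Normalize the midpoint to the identity by a congruence; if its
  determinant were at most one, both transformed matrices would have determinant at least one, and since
  their traces average to the dimension, \<open>trace_le_imp_eq_mat_1\<close> applies to one of them.\<close>
lemma det_midpoint_gt_1:
  fixes A B :: "real^'n^'n"
  assumes A: "A \<in> Sym_pos" "det A = 1" and B: "B \<in> Sym_pos" "det B = 1" and "A \<noteq> B"
  shows "1 < det ((1/2) *\<^sub>R (A + B))"
proof (rule ccontr)
  let ?M = "(1/2) *\<^sub>R (A + B)"
  assume le: "\<not> 1 < det ?M"
  have "?M \<in> Sym_pos"
    by (intro Sym_pos_scaleR Sym_pos_add A B) simp
  then obtain C where C: "0 < det C" "C ** ?M ** transpose C = mat 1"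
    using Sym_pos_orthonormalize by blast
  define A' B' where "A' = C ** A ** transpose C" and "B' = C ** B ** transpose C"
  have sum: "A' + B' = 2 *\<^sub>R mat 1"
  proof -
    have "A' + B' = C ** (A + B) ** transpose C"
      by (simp add: A'_def B'_def matrix_add_ldistrib matrix_add_rdistrib)
    also have "\<dots> = 2 *\<^sub>R (C ** ?M ** transpose C)"
      by (simp add: matrix_scalar_ac scalar_matrix_assoc flip: scaleR_add_right)
    finally show ?thesis
      by (simp add: C(2))
  qed
  have PD: "A' \<in> Sym_pos" "B' \<in> Sym_pos"
    using C(1) A(1) B(1) by (simp_all add: A'_def B'_def Sym_pos_congruence)
  have "(det C)\<^sup>2 * det ?M = 1"
    using arg_cong[OF C(2), of det] by (simp add: det_mul power2_eq_square mult.commute mult.left_commute)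
  then have "1 \<le> (det C)\<^sup>2"
    using le mult_left_mono[of "det ?M" 1 "(det C)\<^sup>2"] by simp
  then have dets: "1 \<le> det A'" "1 \<le> det B'"
    using A(2) B(2) by (simp_all add: A'_def B'_def det_mul power2_eq_square)
  have "trace A' + trace B' = 2 * CARD('n)"
    using arg_cong[OF sum, of trace] by (simp add: trace_def mat_def sum.distrib)
  then consider "trace A' \<le> CARD('n)" | "trace B' \<le> CARD('n)"
    by linarith
  then have "A' = mat 1 \<or> B' = mat 1"
    using trace_le_imp_eq_mat_1[OF PD(1) dets(1)] trace_le_imp_eq_mat_1[OF PD(2) dets(2)] by auto
  then have "A' = B'"
    using sum by (auto simp: scaleR_2)
  have "invertible C" "invertible (transpose C)"
    using C(1) by (simp_all add: invertible_det_nz)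
  then have "A = B"
    using \<open>A' = B'\<close> unfolding A'_def B'_def
    by (metis invertible_def matrix_mul_assoc matrix_mul_lid matrix_mul_rid)
  then show False
    using \<open>A \<noteq> B\<close> by simp
qed

text \<open>Determinant one turns positive semidefinite into positive definite; the closed conditions on the
  right-hand side are what compactness arguments need.\<close>
lemma Sym_pos_SL_eq:
  "Sym_pos \<inter> SL = {A::real^'n^'n. transpose A = A \<and> (\<forall>x. 0 \<le> x \<bullet> (A *v x)) \<and> det A = 1}"
proof (intro equalityI subsetI)
  fix A :: "real^'n^'n"
  assume "A \<in> Sym_pos \<inter> SL"
  then show "A \<in> {A. transpose A = A \<and> (\<forall>x. 0 \<le> x \<bullet> (A *v x)) \<and> det A = 1}"
    using Sym_posD(1)[of A] Sym_posD(3)[of A] by (auto simp: SL_def)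
next
  fix A :: "real^'n^'n"
  assume "A \<in> {A. transpose A = A \<and> (\<forall>x. 0 \<le> x \<bullet> (A *v x)) \<and> det A = 1}"
  then have sym: "transpose A = A" and psd: "\<And>x. 0 \<le> x \<bullet> (A *v x)" and det: "det A = 1"
    by auto
  have "0 < x \<bullet> (A *v x)" if "x \<noteq> 0" for x
  proof (rule ccontr)
    assume "\<not> 0 < x \<bullet> (A *v x)"
    then have x0: "x \<bullet> (A *v x) = 0"
      using psd[of x] by simp
    define y where "y = A *v x"
    define q where "q = y \<bullet> (A *v y)"
    have "y \<noteq> 0"
      using det that matrix_left_invertible_ker[of A] invertible_left_inverse[of A]
      by (auto simp: y_def invertible_det_nz)
    then have yy: "0 < y \<bullet> y"
      by simp
    have poly: "0 \<le> 2 * t * (y \<bullet> y) + t\<^sup>2 * q" for t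
    proof -
      have "0 \<le> (x + t *\<^sub>R y) \<bullet> (A *v (x + t *\<^sub>R y))"
        by (rule psd)
      also have "\<dots> = 2 * t * (y \<bullet> y) + t\<^sup>2 * q"
        using x0 inner_symmetric_matrix[OF sym, of x y]
        by (simp add: algebra_simps matrix_vector_mult_scaleR power2_eq_square q_def flip: y_def)
      finally show ?thesis .
    qed
    have q: "0 \<le> q"
      using psd by (simp add: q_def)
    \<comment> \<open>A step of length \<open>y \<bullet> y / (1 + q)\<close> against \<open>y\<close> makes the linear term win.\<close>
    define s where "s = (y \<bullet> y) / (1 + q)"
    have "0 < s" and sq: "s * (1 + q) = y \<bullet> y"
      using yy q by (simp_all add: s_def)
    have "s * (2 * (y \<bullet> y)) \<le> s * (s * q)"
      using poly[of "- s"] by (simp add: power2_eq_square algebra_simps)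
    then have "2 * (y \<bullet> y) \<le> s * q"
      using \<open>0 < s\<close> by (simp only: mult_le_cancel_left_pos)
    also have "\<dots> \<le> y \<bullet> y"
      unfolding sq[symmetric] using \<open>0 < s\<close> by (simp add: algebra_simps)
    finally show False
      using yy by simp
  qed
  then show "A \<in> Sym_pos \<inter> SL"
    using sym det by (auto simp: Sym_pos_def Sym_def SL_def)
qed

lemma continuous_on_det: "continuous_on S (det :: real^'n^'n \<Rightarrow> real)"
  unfolding det_def[abs_def] by (intro continuous_intros)

lemma closed_Sym_pos_SL: "closed (Sym_pos \<inter> SL :: (real^'n^'n) set)"
proof -
  have cont: "continuous_on UNIV (\<lambda>A::real^'n^'n. A *v x)" for x
    unfolding matrix_vector_mult_def by (intro continuous_intros)
  have "closed {A::real^'n^'n. transpose A = A}"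
    unfolding transpose_def by (intro closed_Collect_eq continuous_intros)
  moreover have "closed {A::real^'n^'n. \<forall>x. 0 \<le> x \<bullet> (A *v x)}"
    by (intro closed_Collect_all closed_Collect_le continuous_on_const continuous_on_inner cont)
  moreover have "closed {A::real^'n^'n. det A = 1}"
    by (intro closed_Collect_eq continuous_on_const continuous_on_det)
  ultimately show ?thesis
    unfolding Sym_pos_SL_eq by (intro closed_Collect_conj)
qed

text \<open>A permutation other than the identity moves at least two indices, so its summand in the Leibniz
  formula vanishes to second order at the identity matrix.\<close>
lemma has_derivative_det_mat_1: "(det has_derivative trace) (at (mat 1 :: real^'n^'n))"
proof -
  have "((\<lambda>A::real^'n^'n. \<Sum>p | p permutes UNIV. of_int (sign p) * (\<Prod>i\<in>UNIV. A $ i $ p i)) has_derivative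
      (\<lambda>E. \<Sum>p | p permutes UNIV. of_int (sign p) *
          (\<Sum>i\<in>UNIV. E $ i $ p i * (\<Prod>j\<in>UNIV - {i}. mat 1 $ j $ p j)))) (at (mat 1))"
    by (auto intro!: derivative_eq_intros bounded_linear_imp_has_derivative simp: sum_distrib_left
        intro: bounded_linear_compose[OF bounded_linear_vec_nth bounded_linear_vec_nth])
  moreover have "(\<Sum>p | p permutes UNIV. of_int (sign p) *
          (\<Sum>i\<in>UNIV. E $ i $ p i * (\<Prod>j\<in>UNIV - {i}. mat 1 $ j $ p j))) = trace E" for E :: "real^'n^'n"
  proof -
    have "(\<Prod>j\<in>UNIV - {i}. mat 1 $ j $ p j :: real) = 0" if "p permutes UNIV" "p \<noteq> id" for p and i :: 'n
    proof -
      have "\<exists>j. j \<noteq> i \<and> p j \<noteq> j"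
      proof (rule ccontr)
        assume "\<nexists>j. j \<noteq> i \<and> p j \<noteq> j"
        then have fixed: "p k = k" if "k \<noteq> i" for k
          using that by blast
        then have "p i = i"
          using permutes_inj[OF \<open>p permutes UNIV\<close>] by (metis injD)
        then show False
          using fixed \<open>p \<noteq> id\<close> by (metis eq_id_iff)
      qed
      then obtain j where "j \<noteq> i" "p j \<noteq> j"
        by blast
      then show ?thesis
        by (intro prod_zero) (auto simp: mat_def intro!: bexI[of _ j])
    qed
    then have "(\<Sum>p | p permutes UNIV. of_int (sign p) *
          (\<Sum>i\<in>UNIV. E $ i $ p i * (\<Prod>j\<in>UNIV - {i}. mat 1 $ j $ p j)))
        = (\<Sum>p\<in>{id}. of_int (sign p) * (\<Sum>i\<in>UNIV. E $ i $ p i * (\<Prod>j\<in>UNIV - {i}. mat 1 $ j $ p j)))"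
      by (intro sum.mono_neutral_right) (auto simp: finite_permutations permutes_id simp del: prod_zero_iff)
    then show ?thesis
      by (simp add: mat_def trace_def sign_id)
  qed
  ultimately show ?thesis
    by (simp add: det_def[abs_def] fun_eq_iff)
qed

text \<open>Along matrices of determinant one, the first-order expansion of \<open>det\<close> at the identity reads
  \<open>trace (A - Id) = o(|A - Id|)\<close>.\<close>
lemma trace_normalized_tendsto_0:
  fixes A :: "'a \<Rightarrow> real^'n^'n"
  assumes lim: "(A \<longlongrightarrow> mat 1) F" and det: "eventually (\<lambda>r. det (A r) = 1) F"
  shows "((\<lambda>r. trace ((1 / norm (A r - mat 1)) *\<^sub>R (A r - mat 1))) \<longlongrightarrow> 0) F"
proof (rule tendstoI)
  fix e :: real
  assume e: "0 < e"
  note deriv = has_derivative_det_mat_1[unfolded has_derivative_at_alt, THEN conjunct2]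
  from deriv[rule_format, OF half_gt_zero[OF e]]
obtain d where d: "0 < d" "\<And>B::real^'n^'n. norm (B - mat 1) < d \<Longrightarrow>
      \<bar>det B - 1 - trace (B - mat 1)\<bar> \<le> e / 2 * norm (B - mat 1)"
    unfolding real_norm_def det_I by blast
  have "eventually (\<lambda>r. dist (A r) (mat 1) < d) F"
    using lim d(1) by (rule tendstoD)
  then show "eventually (\<lambda>r. dist (trace ((1 / norm (A r - mat 1)) *\<^sub>R (A r - mat 1))) 0 < e) F"
    using det
  proof eventually_elim
    case (elim r)
    let ?E = "A r - mat 1"
    have tr: "trace ((1 / norm ?E) *\<^sub>R ?E) = trace ?E / norm ?E"
      by (simp add: trace_def sum_divide_distrib)
    have "\<bar>trace ?E\<bar> \<le> e / 2 * norm ?E"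
      using d(2)[of "A r"] elim by (simp add: dist_norm)
    then have "\<bar>trace ?E\<bar> / norm ?E \<le> e / 2"
      using e by (cases "?E = 0") (simp_all add: pos_divide_le_eq del: le_divide_eq_numeral1)
    then have "\<bar>trace ?E\<bar> / norm ?E < e"
      using e by linarith
    then show ?case
      unfolding tr by (simp add: abs_divide)
  qed
qed

lemma frobenius_norm_eq_norm: "frobenius_norm A = norm A"
proof -
  have "trace (transpose A ** A) = (\<Sum>i\<in>UNIV. \<Sum>j\<in>UNIV. (A $ i $ j)\<^sup>2)"
    by (subst sum.swap) (simp add: trace_def matrix_matrix_mult_def transpose_def power2_eq_square)
  also have "\<dots> = (norm A)\<^sup>2"
    by (simp add: norm_vec_def L2_set_def sum_nonneg)
  finally show ?thesis
    by (simp add: frobenius_norm_def)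
qed

section \<open>Bodies in Loewner position\<close>

lemma measure_affine_image:
  fixes T :: "real^'n^'n"
  assumes "S \<in> lmeasurable"
  shows "measure lebesgue ((\<lambda>x. T *v x + c) ` S) = \<bar>det T\<bar> * measure lebesgue S"
proof -
  have "(\<lambda>x. T *v x + c) ` S = (+) c ` (*v) T ` S"
    by (simp add: image_image add.commute)
  then show ?thesis
    using measure_linear_image_finite[OF matrix_vector_mul_linear assms, of T]
    by (simp add: measure_translation)
qed

lemma loewner_subset_cball: "loewner_position K \<Longrightarrow> K \<subseteq> cball 0 1"
  by (simp add: loewner_position_def unique_minimum_on_def is_arg_min_def)

text \<open>The preimage of the unit ball is an ellipsoid containing \<open>K\<close>, whose volume is that of the ball divided by
  \<open>|det T|\<close>; minimality and uniqueness of the Loewner ellipsoid give the two parts.\<close>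
lemma loewner_affine_image:
  fixes K :: "(real^'n) set"
  assumes K: "loewner_position K" and T: "(\<lambda>x. T *v x + v) ` K \<subseteq> cball 0 1"
  shows "\<bar>det T\<bar> \<le> 1"
    and "\<bar>det T\<bar> = 1 \<Longrightarrow> (\<lambda>x. T *v x + v) ` cball 0 1 = cball 0 1"
proof -
  have "\<bar>det T\<bar> \<le> 1 \<and> (\<bar>det T\<bar> = 1 \<longrightarrow> (\<lambda>x. T *v x + v) ` cball 0 1 = cball 0 1)"
  proof (cases "det T = 0")
    case False
    let ?f = "\<lambda>x. T *v x + v"
    obtain T' where T': "T ** T' = mat 1" "T' ** T = mat 1"
      using False unfolding invertible_det_nz[symmetric] invertible_def by blast
    define h where "h = (\<lambda>y. T' *v y + (- (T' *v v)))"
    have hf: "h (?f x) = x" and fh: "?f (h x) = x" for x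
      using T' by (simp_all add: h_def matrix_vector_right_distrib matrix_vector_mult_diff_distrib
          matrix_vector_mul_assoc)
    let ?E = "h ` cball 0 1"
    have "invertible T'"
      using T' unfolding invertible_def by blast
    then have "ellipsoid ?E"
      unfolding ellipsoid_def h_def by blast
    moreover have "K \<subseteq> ?E"
    proof
      fix x assume "x \<in> K"
      then have "?f x \<in> cball 0 1"
        using T by blast
      then show "x \<in> ?E"
        using hf[of x] by (metis imageI)
    qed
    ultimately have E: "?E \<in> {E. ellipsoid E \<and> K \<subseteq> E}"
      by simp
    have detT': "\<bar>det T\<bar> * \<bar>det T'\<bar> = 1"
      using arg_cong[OF T'(1), of det] by (simp add: det_mul abs_mult[symmetric])
    have mE: "measure lebesgue ?E = \<bar>det T'\<bar> * measure lebesgue (cball (0::real^'n) 1)"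
      unfolding h_def by (rule measure_affine_image) simp
    have pos: "0 < measure lebesgue (cball (0::real^'n) 1)"
      by (simp add: content_cball_pos)
    have min: "\<not> measure lebesgue ?E < measure lebesgue (cball (0::real^'n) 1)"
      using K E unfolding loewner_position_def unique_minimum_on_def is_arg_min_def by blast
    then have T'1: "1 \<le> \<bar>det T'\<bar>"
      unfolding mE using pos by simp
    have le: "\<bar>det T\<bar> \<le> 1"
      using mult_left_mono[OF T'1, of "\<bar>det T\<bar>"] detT' by simp
    moreover have "?f ` cball 0 1 = cball 0 1" if "\<bar>det T\<bar> = 1"
    proof -
      have "measure lebesgue ?E = measure lebesgue (cball (0::real^'n) 1)"
        using mE detT' that by simp
      then have "is_arg_min (measure lebesgue) (\<lambda>x. x \<in> {E. ellipsoid E \<and> K \<subseteq> E}) ?E"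
        using K E unfolding loewner_position_def unique_minimum_on_def is_arg_min_def by simp
      then have "?E = cball 0 1"
        using K unfolding loewner_position_def unique_minimum_on_def by blast
      then have "?f ` cball 0 1 = ?f ` h ` cball 0 1"
        by simp
      then show ?thesis
        using fh by (simp add: image_image)
    qed
    ultimately show ?thesis
      by blast
  qed simp
  then show "\<bar>det T\<bar> \<le> 1" and "\<bar>det T\<bar> = 1 \<Longrightarrow> (\<lambda>x. T *v x + v) ` cball 0 1 = cball 0 1"
    by blast+
qed

text \<open>Adding the conditions \<open>|A x + v| \<le> 1\<close> and \<open>|- A x + v| \<le> 1\<close> shows \<open>|A x|\<^sup>2 + |v|\<^sup>2 \<le> 1\<close> for unit vectors.
  So the diagonal of \<open>A\<close> is at most one, the trace bound forces the identity, and then \<open>v = 0\<close>.\<close>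
lemma Sym_pos_maps_cball_into_cball:
  fixes A :: "real^'n^'n"
  assumes A: "A \<in> Sym_pos" "det A = 1" and sub: "(\<lambda>x. A *v x + v) ` cball 0 1 \<subseteq> cball 0 1"
  shows "A = mat 1 \<and> v = 0"
proof -
  have bound: "(norm (A *v x))\<^sup>2 + (norm v)\<^sup>2 \<le> 1" if "norm x = 1" for x
  proof -
    have "norm (A *v x + v) \<le> 1" "norm (A *v (- x) + v) \<le> 1"
      using sub that by (auto simp: image_subset_iff)
    then have "(norm (A *v x + v))\<^sup>2 \<le> 1" "(norm (A *v (- x) + v))\<^sup>2 \<le> 1"
      by (simp_all add: power_le_one)
    moreover have "A *v (- x) = - (A *v x)"
      using matrix_vector_mult_scaleR[of A "-1" x] by simp
    ultimately show ?thesis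
      by (simp add: power2_norm_eq_inner algebra_simps inner_commute)
  qed
  have "A $ i $ i \<le> 1" for i
  proof -
    have "A $ i $ i \<le> \<bar>(A *v axis i 1) $ i\<bar>"
      by (simp add: matrix_vector_mult_basis column_def)
    also have "\<dots> \<le> norm (A *v axis i 1)"
      by (rule component_le_norm_cart)
    also have "\<dots> \<le> 1"
      using bound[of "axis i 1"] power2_le_imp_le[of "norm (A *v axis i 1)" 1]
      by (smt (verit) norm_axis_1 one_power2 zero_le_power2)
    finally show ?thesis .
  qed
  then have "trace A \<le> CARD('n)"
    unfolding trace_def using sum_mono[of UNIV "\<lambda>i. A $ i $ i" "\<lambda>_. 1"] by simp
  then have A1: "A = mat 1"
    using trace_le_imp_eq_mat_1 A by force
  show ?thesis
    using bound[of "axis undefined 1"] A1 by (simp add: norm_axis_1)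
qed

text \<open>Stretch the unit ball by \<open>1 + a\<close> in one direction, contract it by \<open>1 - a\<^sup>2\<close> in the orthogonal directions,
  and shift back by \<open>a\<close>.  The left-hand side bounds the squared norm of the image of a point with coordinate
  \<open>t\<close> in the special direction.  It is convex in \<open>t\<close>, so the endpoints \<open>0\<close> and \<open>1\<close> decide:
  the half ball \<open>t \<ge> 0\<close> stays in the unit ball.\<close>
lemma half_ball_expansion_bound:
  fixes a t :: real
  assumes a: "0 \<le> a" "a \<le> 1" and t: "0 \<le> t" "t \<le> 1"
  shows "((1 + a) * t - a)\<^sup>2 + (1 - a\<^sup>2)\<^sup>2 * (1 - t\<^sup>2) \<le> 1"
proof -
  have a2: "a\<^sup>2 \<le> 1"
    using a by (simp add: power_le_one)
  have "a\<^sup>2 + (1 - a\<^sup>2)\<^sup>2 = 1 - a\<^sup>2 * (1 - a\<^sup>2)"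
    by algebra
  also have "\<dots> \<le> 1"
    using a2 by simp
  finally have c: "a\<^sup>2 + (1 - a\<^sup>2)\<^sup>2 \<le> 1" .
  have b: "(1 - a\<^sup>2)\<^sup>2 \<le> (1 + a)\<^sup>2"
  proof (rule power_mono)
    show "1 - a\<^sup>2 \<le> 1 + a"
      using a(1) zero_le_power2[of a] by linarith
  qed (use a2 in simp)
  have tt: "t\<^sup>2 \<le> t"
    using t by (simp add: power2_eq_square mult_left_le)
  have "((1 + a) * t - a)\<^sup>2 + (1 - a\<^sup>2)\<^sup>2 * (1 - t\<^sup>2)
      = ((1 + a)\<^sup>2 - (1 - a\<^sup>2)\<^sup>2) * t\<^sup>2 - 2 * a * (1 + a) * t + a\<^sup>2 + (1 - a\<^sup>2)\<^sup>2"
    by algebra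
  also have "\<dots> \<le> ((1 + a)\<^sup>2 - (1 - a\<^sup>2)\<^sup>2) * t - 2 * a * (1 + a) * t + a\<^sup>2 + (1 - a\<^sup>2)\<^sup>2"
    using mult_left_mono[OF tt, of "(1 + a)\<^sup>2 - (1 - a\<^sup>2)\<^sup>2"] b by simp
  also have "\<dots> = t + (1 - t) * (a\<^sup>2 + (1 - a\<^sup>2)\<^sup>2)"
    by algebra
  also have "\<dots> \<le> t + (1 - t) * 1"
    using c t by (intro add_left_mono mult_left_mono) auto
  finally show ?thesis
    by simp
qed

text \<open>The stretch gains a first-order amount of volume, the contraction loses a second-order one.\<close>
lemma half_ball_expansion_det:
  fixes a :: real
  assumes a: "0 < a" "2 * real n * a \<le> 1" and n: "1 \<le> n"
  shows "1 < (1 + a) * (1 - a\<^sup>2) ^ (n - 1)"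
proof -
  have a1: "a \<le> 1 / 2"
    using a n mult_right_mono[of 1 "real n" a] by linarith
  have "1 + real (n - 1) * (- (a\<^sup>2)) \<le> (1 + - (a\<^sup>2)) ^ (n - 1)"
    using a a1 power_le_one[of a 2] by (intro Bernoulli_inequality) simp
  then have B: "1 - real (n - 1) * a\<^sup>2 \<le> (1 - a\<^sup>2) ^ (n - 1)"
    by simp
  have "real (n - 1) * a * (1 + a) \<le> (1 / 2) * (1 + a)"
    using a n by (intro mult_right_mono) (auto simp: of_nat_diff algebra_simps)
  also have "\<dots> < 1"
    using a1 by simp
  finally have "a * (real (n - 1) * a * (1 + a)) < a * 1"
    using a(1) by (intro mult_strict_left_mono)
  then have "1 < (1 + a) * (1 - real (n - 1) * a\<^sup>2)"
    by (simp add: algebra_simps power2_eq_square)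
  also have "\<dots> \<le> (1 + a) * (1 - a\<^sup>2) ^ (n - 1)"
    using B a by (intro mult_left_mono) auto
  finally show ?thesis .
qed

text \<open>Otherwise \<open>K\<close> lies in a half ball, and the map of \<open>half_ball_expansion_bound\<close>, rotated to the separating
  direction, keeps \<open>K\<close> in the unit ball although its determinant exceeds one.\<close>
lemma loewner_0_in_interior:
  fixes K :: "(real^'n) set"
  assumes body: "convex_body K" and K: "loewner_position K"
  shows "0 \<in> interior K"
proof (rule ccontr)
  assume "0 \<notin> interior K"
  have conv: "convex K" "compact K" and ne: "interior K \<noteq> {}"
    using body by (auto simp: convex_body_def)
  have "\<exists>a. a \<noteq> 0 \<and> (\<forall>x\<in>interior K. 0 \<le> a \<bullet> x)"
    by (rule separating_hyperplane_set_0[OF convex_interior[OF conv(1)] \<open>0 \<notin> interior K\<close>])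
  then obtain a where a: "a \<noteq> 0" "interior K \<subseteq> {x. 0 \<le> a \<bullet> x}"
    by auto
  have "K \<subseteq> closure (interior K)"
    unfolding convex_closure_interior[OF conv(1) ne] by (rule closure_subset)
  also have "\<dots> \<subseteq> {x. 0 \<le> a \<bullet> x}"
    using a(2) by (intro closure_minimal closed_halfspace_ge)
  finally have half: "\<And>x. x \<in> K \<Longrightarrow> 0 \<le> a \<bullet> x"
    by auto
  define k :: 'n where "k = undefined"
  have norms: "norm (sgn a) = norm (axis k (1::real))"
    using a(1) by (simp add: norm_sgn norm_axis_1)
  obtain f :: "real^'n \<Rightarrow> real^'n" where f: "orthogonal_transformation f" "f (sgn a) = axis k 1"
    using orthogonal_transformation_exists[OF norms] by blast
  have lin: "linear f" and inner_f: "\<And>x y. f x \<bullet> f y = x \<bullet> y"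
    using f(1) unfolding orthogonal_transformation_def by simp_all
  \<comment> \<open>Small enough for \<open>half_ball_expansion_det\<close> in dimension \<open>CARD('n)\<close>.\<close>
  define s :: real where "s = 1 / (2 * CARD('n))"
  have s: "0 < s" "2 * real CARD('n) * s \<le> 1" "s \<le> 1"
  proof -
    have "1 \<le> 2 * real CARD('n)"
      using zero_less_card_finite[where 'a='n] by linarith
    then show "0 < s" "2 * real CARD('n) * s \<le> 1" "s \<le> 1"
      by (simp_all add: s_def)
  qed
  define D :: "real^'n^'n" where
    "D = (\<chi> i j. if i = j then (if i = k then 1 + s else 1 - s\<^sup>2) else 0)"
  define T where "T = D ** matrix f"
  define v :: "real^'n" where "v = - s *\<^sub>R axis k 1"
  have Dv: "(D *v y) $ i = (if i = k then 1 + s else 1 - s\<^sup>2) * y $ i" for y i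
  proof -
    have "(D *v y) $ i = (\<Sum>j\<in>UNIV. if j = i then (if i = k then 1 + s else 1 - s\<^sup>2) * y $ i else 0)"
      unfolding matrix_vector_mul_component inner_vec_def D_def by (intro sum.cong) auto
    then show ?thesis
      by simp
  qed
  have "det D = (\<Prod>i\<in>UNIV. if i = k then 1 + s else 1 - s\<^sup>2)"
    by (subst det_diagonal) (auto simp: D_def)
  also have "\<dots> = (1 + s) * (1 - s\<^sup>2) ^ (CARD('n) - 1)"
  proof -
    have "(\<Prod>i\<in>UNIV. if i = k then 1 + s else 1 - s\<^sup>2)
        = (1 + s) * (\<Prod>i\<in>UNIV - {k}. if i = k then 1 + s else 1 - s\<^sup>2)"
      by (subst prod.remove[of _ k]) auto
    also have "(\<Prod>i\<in>UNIV - {k}. if i = k then 1 + s else 1 - s\<^sup>2) = (\<Prod>i\<in>UNIV - {k}. 1 - s\<^sup>2)"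
      by (rule prod.cong) auto
    finally show ?thesis
      by (simp add: card_Diff_singleton)
  qed
  finally have "1 < det D"
    using half_ball_expansion_det[OF s(1,2)] by simp
  moreover have "\<bar>det (matrix f)\<bar> = 1"
    using f(1) orthogonal_transformation_det by blast
  ultimately have "1 < \<bar>det T\<bar>"
    by (simp add: T_def det_mul abs_mult)
  moreover have "norm (T *v x + v) \<le> 1" if "x \<in> K" for x
  proof -
    define y where "y = f x"
    have "y $ k = f (sgn a) \<bullet> f x"
      by (simp add: f(2) y_def inner_axis')
    also have "\<dots> = sgn a \<bullet> x"
      by (rule inner_f)
    finally have yk: "0 \<le> y $ k"
      using half[OF that] by (simp add: sgn_div_norm)
    have "norm y \<le> 1"
      using that loewner_subset_cball[OF K] f(1) orthogonal_transformation_norm[OF f(1)]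
      by (auto simp: y_def)
    then have ny: "(norm y)\<^sup>2 \<le> 1" and yk1: "y $ k \<le> 1"
      using component_le_norm_cart[of y k] by (auto simp: power_le_one)
    have split: "(norm z)\<^sup>2 = (z $ k)\<^sup>2 + (\<Sum>i\<in>UNIV - {k}. (z $ i)\<^sup>2)" for z :: "real^'n"
      by (simp add: norm_vec_def L2_set_def sum_nonneg sum.remove[of UNIV k])
    have "T *v x = D *v y"
      using fun_cong[OF matrix_vector_mul(2)[OF lin], of x]
      by (simp add: T_def y_def flip: matrix_vector_mul_assoc)
    then have comp: "(T *v x + v) $ i = (if i = k then (1 + s) * y $ k - s else (1 - s\<^sup>2) * y $ i)" for i
      by (simp add: Dv v_def axis_def)
    have "(norm (T *v x + v))\<^sup>2 = ((1 + s) * y $ k - s)\<^sup>2 + (\<Sum>i\<in>UNIV - {k}. ((1 - s\<^sup>2) * y $ i)\<^sup>2)"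
      unfolding split comp by simp
    also have "\<dots> = ((1 + s) * y $ k - s)\<^sup>2 + (1 - s\<^sup>2)\<^sup>2 * ((norm y)\<^sup>2 - (y $ k)\<^sup>2)"
      unfolding split[of y] by (simp add: sum_distrib_left power_mult_distrib)
    also have "\<dots> \<le> ((1 + s) * y $ k - s)\<^sup>2 + (1 - s\<^sup>2)\<^sup>2 * (1 - (y $ k)\<^sup>2)"
      using ny by (intro add_left_mono mult_left_mono) auto
    also have "\<dots> \<le> 1"
      using s yk yk1 by (intro half_ball_expansion_bound) auto
    finally show ?thesis
      using power2_le_imp_le[of "norm (T *v x + v)" 1] by simp
  qed
  then have "\<bar>det T\<bar> \<le> 1"
    by (intro loewner_affine_image(1)[OF K, of T v]) auto
  ultimately show False
    by simp
qed

section \<open>The gauge function and weights supported on convex bodies\<close>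

lemma gauge_le:
  assumes "0 < l" "x \<in> (\<lambda>y. l *\<^sub>R y) ` K"
  shows "gauge_function K x \<le> l"
  unfolding gauge_function_def using assms by (intro cInf_lower) (auto intro!: bdd_belowI[of _ 0])

lemma gauge_less_imp_mem:
  fixes K :: "(real^'n) set"
  assumes K: "convex K" "0 \<in> interior K" and x: "gauge_function K x < l"
  shows "0 < l \<and> x \<in> (\<lambda>y. l *\<^sub>R y) ` K"
proof -
  obtain e where e: "0 < e" "cball 0 e \<subseteq> K"
    using K(2) by (meson mem_interior_cball)
  have x': "x = ((norm x + 1) / e) *\<^sub>R ((e / (norm x + 1)) *\<^sub>R x)"
    using e(1) by (simp add: add_nonneg_eq_0_iff)
  have "(e / (norm x + 1)) *\<^sub>R x \<in> K"
    using e by (intro subsetD[OF e(2)]) (simp add: divide_le_eq mult_left_mono add_nonneg_pos)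
  then have ne: "{l. 0 < l \<and> x \<in> (\<lambda>y. l *\<^sub>R y) ` K} \<noteq> {}"
  proof -
    assume mem: "(e / (norm x + 1)) *\<^sub>R x \<in> K"
    have "x \<in> (\<lambda>y. ((norm x + 1) / e) *\<^sub>R y) ` K"
      using x' mem by (rule image_eqI)
    moreover have "0 < (norm x + 1) / e"
      using e(1) by (simp add: add_nonneg_pos)
    ultimately show ?thesis
      by blast
  qed
  obtain m where m: "m < l" "0 < m" "x \<in> (\<lambda>y. m *\<^sub>R y) ` K"
    using cInf_lessD[OF ne x[unfolded gauge_function_def]] by auto
  then obtain y where y: "y \<in> K" "x = m *\<^sub>R y"
    by auto
  have "(m / l) *\<^sub>R y + (1 - m / l) *\<^sub>R 0 \<in> K"
    using K(1) y(1) interior_subset[of K] K(2) m by (intro convexD) auto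
  then show ?thesis
    using m y by (auto intro!: image_eqI[of _ _ "(m / l) *\<^sub>R y"])
qed

text \<open>Sublevel sets of the gauge are intersections of dilates of \<open>K\<close>, hence closed; this is how measurability
  is obtained.\<close>
lemma gauge_le_iff:
  fixes K :: "(real^'n) set"
  assumes K: "convex K" "0 \<in> interior K" and "0 \<le> l"
  shows "gauge_function K x \<le> l \<longleftrightarrow> (\<forall>m>l. x \<in> (\<lambda>y. m *\<^sub>R y) ` K)"
proof (intro iffI allI impI)
  fix m assume "gauge_function K x \<le> l" "l < m"
  then have "gauge_function K x < m"
    by (rule le_less_trans)
  then show "x \<in> (\<lambda>y. m *\<^sub>R y) ` K"
    using gauge_less_imp_mem[OF K] by blast
next
  assume mem: "\<forall>m>l. x \<in> (\<lambda>y. m *\<^sub>R y) ` K"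
  show "gauge_function K x \<le> l"
  proof (rule dense_ge)
    fix m assume "l < m"
    then show "gauge_function K x \<le> m"
      using mem \<open>0 \<le> l\<close> by (intro gauge_le) auto
  qed
qed

lemma borel_measurable_gauge:
  fixes K :: "(real^'n) set"
  assumes K: "convex K" "compact K" "0 \<in> interior K"
  shows "gauge_function K \<in> borel_measurable borel"
proof (rule borel_measurable_iff_le[THEN iffD2], rule allI)
  fix l
  have nn: "0 \<le> gauge_function K x" for x
    using gauge_less_imp_mem[OF K(1,3), of x 0] by force
  have "closed {x. gauge_function K x \<le> l}"
  proof (cases "0 \<le> l")
    case True
    have "{x. gauge_function K x \<le> l} = (\<Inter>m\<in>{l<..}. (\<lambda>y. m *\<^sub>R y) ` K)"
      using gauge_le_iff[OF K(1,3) True] by auto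
    moreover have "closed ((\<lambda>y. m *\<^sub>R y) ` K)" for m
      using K(2) by (intro compact_imp_closed compact_scaling)
    ultimately show ?thesis
      by (simp add: closed_INT)
  next
    case False
    then have "{x. gauge_function K x \<le> l} = {}"
      using nn by (auto simp: not_le intro: less_le_trans)
    then show ?thesis
      by simp
  qed
  then show "{w \<in> space borel. gauge_function K w \<le> l} \<in> sets borel"
    by simp
qed

text \<open>What existence, uniqueness and continuity arguments use of the weight.  The indicator of a convex body
  is another example, and it serves for the lower bounds.\<close>
definition bump_on :: "(real^'n) set \<Rightarrow> (real^'n \<Rightarrow> real) \<Rightarrow> bool" where
  "bump_on P w \<longleftrightarrow> convex_body P \<and> w \<in> borel_measurable borel \<and>
     (\<forall>x. 0 \<le> w x \<and> w x \<le> 1) \<and> (\<forall>x. x \<notin> P \<longrightarrow> w x = 0) \<and> (\<forall>x\<in>interior P. 0 < w x)"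

lemma bump_on_indicator:
  assumes "convex_body P"
  shows "bump_on P (indicator P)"
proof -
  have "P \<in> sets borel"
    using assms by (simp add: convex_body_def compact_imp_closed borel_closed)
  then show ?thesis
    using assms interior_subset by (auto simp: bump_on_def indicator_def split: if_splits)
qed

lemma interior_scaling_image:
  fixes K :: "(real^'n) set"
  assumes "0 < c"
  shows "interior ((\<lambda>x. c *\<^sub>R x) ` K) = (\<lambda>x. c *\<^sub>R x) ` interior K"
  using assms by (intro interior_injective_linear_image linear_scale_self injI) auto

lemma convex_body_scaling:
  fixes K :: "(real^'n) set"
  assumes "convex_body K" "0 < c"
  shows "convex_body ((\<lambda>x. c *\<^sub>R x) ` K)"
  using assms by (simp add: convex_body_def compact_scaling convex_scaling interior_scaling_image)

lemma scaling_subset: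
  fixes K :: "(real^'n) set"
  assumes K: "convex K" "0 \<in> K" and st: "0 \<le> s" "s \<le> t"
  shows "(\<lambda>x. s *\<^sub>R x) ` K \<subseteq> (\<lambda>x. t *\<^sub>R x) ` K"
proof (intro image_subsetI)
  fix y assume y: "y \<in> K"
  show "s *\<^sub>R y \<in> (\<lambda>x. t *\<^sub>R x) ` K"
  proof (cases "t = 0")
    case True
    then show ?thesis
      using st y by auto
  next
    case False
    then have "(s / t) *\<^sub>R y + (1 - s / t) *\<^sub>R 0 \<in> K"
      using K y st by (intro convexD) auto
    then show ?thesis
      using False by (auto intro!: image_eqI[of _ _ "(s / t) *\<^sub>R y"])
  qed
qed

lemma gauge_weight_eq_1:
  assumes g: "\<forall>x\<le>-1. g x = 1" and r: "0 < r" "r < 1" and x: "x \<in> (\<lambda>x. r *\<^sub>R x) ` K"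
  shows "rescale r g (gauge_function K x) = 1"
  using gauge_le[OF r(1) x] r g by (simp add: rescale_def divide_le_eq)

text \<open>For a point in the interior of \<open>(2 - r) K\<close>, a slightly larger multiple of it still lies in
  \<open>(2 - r) K\<close>, so that its gauge is strictly below \<open>2 - r\<close> and \<open>g\<close> is evaluated strictly below \<open>1\<close>.\<close>
lemma bump_on_gauge_weight:
  fixes K :: "(real^'n) set"
  assumes K: "convex_body K" "0 \<in> interior K"
    and g: "antimono g" "\<forall>x\<le>-1. g x = 1" "\<forall>x\<in>{-1<..<1}. 0 < g x" "\<forall>x\<ge>1. g x = 0"
    and r: "0 < r" "r < 1"
  shows "bump_on ((\<lambda>x. (2 - r) *\<^sub>R x) ` K) (\<lambda>x. rescale r g (gauge_function K x))"
proof -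
  let ?P = "(\<lambda>x. (2 - r) *\<^sub>R x) ` K"
  have conv: "convex K" "compact K"
    using K(1) by (auto simp: convex_body_def)
  have "mono (\<lambda>x. - g x)"
    using g(1) by (auto simp: monotone_def)
  then have "(\<lambda>x. - g x) \<in> borel_measurable borel"
    by (rule borel_measurable_mono)
  then have "g \<in> borel_measurable borel"
    using borel_measurable_uminus[of "\<lambda>x. - g x" borel] by simp
  then have meas: "(\<lambda>x. rescale r g (gauge_function K x)) \<in> borel_measurable borel"
    unfolding rescale_def
    by (rule measurable_compose[rotated]) (use borel_measurable_gauge[OF conv K(2)] in measurable)
  have g01: "0 \<le> g x" "g x \<le> 1" for x
    using g(2,4) antimonoD[OF g(1), of x 1] antimonoD[OF g(1), of "-1" x]
    by (cases "x \<le> 1"; cases "-1 \<le> x"; force)+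
  have out: "rescale r g (gauge_function K x) = 0" if "x \<notin> ?P" for x
  proof -
    have "2 - r \<le> gauge_function K x"
      using gauge_less_imp_mem[OF conv(1) K(2), of x "2 - r"] that by force
    then show ?thesis
      using g(4) r by (simp add: rescale_def le_divide_eq)
  qed
  have pos: "0 < rescale r g (gauge_function K x)" if x: "x \<in> interior ?P" for x
  proof -
    obtain e where e: "0 < e" "cball x e \<subseteq> ?P"
      using x by (meson mem_interior_cball)
    define d where "d = e / (norm x + 1)"
    have d: "0 < d" "d * norm x \<le> e"
      using e(1) by (auto simp: d_def add_nonneg_pos divide_le_eq mult_left_mono)
    have "(1 + d) *\<^sub>R x \<in> ?P"
      using d by (intro subsetD[OF e(2)]) (simp add: dist_norm algebra_simps)
    then obtain y where y: "y \<in> K" "(1 + d) *\<^sub>R x = (2 - r) *\<^sub>R y"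
      by auto
    have "x = (1 / (1 + d)) *\<^sub>R ((1 + d) *\<^sub>R x)"
      using d(1) by simp
    then have "x = ((2 - r) / (1 + d)) *\<^sub>R y"
      unfolding y(2) by simp
    then have "gauge_function K x \<le> (2 - r) / (1 + d)"
      using y(1) r d by (intro gauge_le) auto
    also have "\<dots> < 2 - r"
      using r d by (simp add: divide_less_eq)
    finally have "(gauge_function K x - 1) / (1 - r) < 1"
      using r by (simp add: divide_less_eq)
    then show ?thesis
      using g(2,3) unfolding rescale_def
      by (cases "(gauge_function K x - 1) / (1 - r) \<le> -1") auto
  qed
  show ?thesis
    unfolding bump_on_def
    using convex_body_scaling[OF K(1), of "2 - r"] r meas out pos g01
    by (simp add: rescale_def)
qed

section \<open>Energies of affine maps\<close>

lemma borel_imp_lebesgue_measurable: "h \<in> borel_measurable borel \<Longrightarrow> h \<in> borel_measurable lebesgue"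
  by (rule measurable_completion) simp

lemma bump_onD:
  assumes "bump_on P w"
  shows "compact P" "convex P" "interior P \<noteq> {}" "w \<in> borel_measurable borel"
    "0 \<le> w x" "w x \<le> 1" "x \<notin> P \<Longrightarrow> w x = 0" "x \<in> interior P \<Longrightarrow> 0 < w x"
  using assms by (auto simp: bump_on_def convex_body_def)

lemma bump_on_integrable:
  fixes h :: "real^'n \<Rightarrow> real"
  assumes w: "bump_on P w" and h: "continuous_on UNIV h"
  shows "integrable lebesgue (\<lambda>x. h x * w x)"
proof -
  have "bounded (h ` P)"
    using bump_onD(1)[OF w] continuous_on_subset[OF h] by (intro compact_imp_bounded compact_continuous_image) auto
  then obtain B where B: "\<And>x. x \<in> P \<Longrightarrow> \<bar>h x\<bar> \<le> B"
    by (auto simp: bounded_iff)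
  show ?thesis
  proof (rule Bochner_Integration.integrable_bound)
    show "integrable lebesgue (\<lambda>x. B * indicat_real P x)"
      using lmeasurable_compact[OF bump_onD(1)[OF w]]
      by (intro integrable_mult_right integrable_real_indicator) (auto simp: fmeasurable_def)
    show "(\<lambda>x. h x * w x) \<in> borel_measurable lebesgue"
      using bump_onD(4)[OF w] borel_measurable_continuous_onI[OF h]
      by (intro borel_imp_lebesgue_measurable borel_measurable_times)
    show "AE x in lebesgue. norm (h x * w x) \<le> norm (B * indicat_real P x)"
    proof (rule AE_I2)
      fix x
      show "norm (h x * w x) \<le> norm (B * indicat_real P x)"
      proof (cases "x \<in> P")
        case True
        have "\<bar>h x\<bar> * w x \<le> B * 1"
          using B[OF True] bump_onD(5,6)[OF w] by (intro mult_mono) (auto intro: order_trans[OF abs_ge_zero])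
        then show ?thesis
          using True bump_onD(5)[OF w, of x] by (simp add: abs_mult)
      qed (simp add: bump_onD(7)[OF w])
    qed
  qed
qed

text \<open>The source of every strict inequality below: ordered continuous functions with equal weighted
  integrals agree almost everywhere on the interior of \<open>P\<close>, hence on its closure, which contains \<open>P\<close>.\<close>
lemma continuous_agree_on_convex_body:
  fixes h1 h2 :: "real^'n \<Rightarrow> real"
  assumes w: "bump_on P w" and h: "continuous_on UNIV h1" "continuous_on UNIV h2"
    and le: "\<And>x. x \<in> P \<Longrightarrow> h1 x \<le> h2 x"
    and int: "(LINT x|lebesgue. h2 x * w x) \<le> (LINT x|lebesgue. h1 x * w x)"
    and x: "x \<in> P"
  shows "h1 x = h2 x"
proof -
  note i1 = bump_on_integrable[OF w h(1)] and i2 = bump_on_integrable[OF w h(2)]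
  let ?d = "\<lambda>x. h2 x * w x - h1 x * w x"
  have nn: "0 \<le> ?d x" for x
    using le[of x] bump_onD(5,7)[OF w, of x]
    by (cases "x \<in> P") (auto intro: mult_right_mono)
  have "(LINT x|lebesgue. ?d x) = 0"
  proof (rule antisym)
    show "(LINT x|lebesgue. ?d x) \<le> 0"
      using int i1 i2 by simp
    show "0 \<le> (LINT x|lebesgue. ?d x)"
      using nn by (intro integral_nonneg_AE) simp
  qed
  then have AE: "AE x in lebesgue. ?d x = 0"
    using nn i1 i2 by (subst (asm) integral_nonneg_eq_0_iff_AE) auto
  have closed: "closed {x. h1 x = h2 x}"
    using h by (rule closed_Collect_eq)
  have "interior P \<subseteq> {x. h1 x = h2 x}"
  proof
    fix x assume x: "x \<in> interior P"
    have "AE y \<in> interior P in lebesgue. y \<in> {x. h1 x = h2 x}"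
      using AE
    proof eventually_elim
      case (elim y)
      then show ?case
        using bump_onD(8)[OF w, of y] by (auto simp flip: left_diff_distrib)
    qed
    then show "x \<in> {x. h1 x = h2 x}"
      by (rule mem_closed_if_AE_lebesgue_open[OF open_interior closed _ x])
  qed
  then have "closure (interior P) \<subseteq> {x. h1 x = h2 x}"
    using closed by (rule closure_minimal)
  moreover have "P \<subseteq> closure (interior P)"
    unfolding convex_closure_interior[OF bump_onD(2,3)[OF w]] by (rule closure_subset)
  ultimately show ?thesis
    using x by blast
qed

definition affine_energy :: "(real^'n \<Rightarrow> real) \<Rightarrow> (real^'n \<Rightarrow> real) \<Rightarrow> (real^'n^'n) \<times> (real^'n) \<Rightarrow> real" where
  "affine_energy \<phi> w p = (LINT x|lebesgue. \<phi> (fst p *v x + snd p) * w x)"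

lemma continuous_on_affine_map:
  "continuous_on UNIV (\<lambda>q::((real^'n^'n) \<times> (real^'n)) \<times> (real^'n). fst (fst q) *v snd q + snd (fst q))"
  unfolding matrix_vector_mult_def by (intro continuous_intros)

lemma continuous_on_affine_compose:
  fixes \<phi> :: "real^'n \<Rightarrow> real" and p :: "(real^'n^'n) \<times> (real^'n)"
  assumes "continuous_on UNIV \<phi>"
  shows "continuous_on UNIV (\<lambda>x. \<phi> (fst p *v x + snd p))"
  by (rule continuous_on_compose2[OF assms]) (auto intro!: continuous_intros)

lemma affine_energy_integrable:
  fixes \<phi> :: "real^'n \<Rightarrow> real" and p :: "(real^'n^'n) \<times> (real^'n)"
  assumes "bump_on P w" "continuous_on UNIV \<phi>"
  shows "integrable lebesgue (\<lambda>x. \<phi> (fst p *v x + snd p) * w x)"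
  by (rule bump_on_integrable[OF assms(1) continuous_on_affine_compose[OF assms(2)]])

lemma affine_energy_mono:
  fixes \<phi> \<psi> :: "real^'n \<Rightarrow> real" and p q :: "(real^'n^'n) \<times> (real^'n)"
  assumes w: "bump_on P w" and \<phi>: "continuous_on UNIV \<phi>" "continuous_on UNIV \<psi>"
    and le: "\<And>x. x \<in> P \<Longrightarrow> \<phi> (fst p *v x + snd p) \<le> \<psi> (fst q *v x + snd q)"
  shows "affine_energy \<phi> w p \<le> affine_energy \<psi> w q"
  unfolding affine_energy_def
proof (rule integral_mono)
  fix x
  show "\<phi> (fst p *v x + snd p) * w x \<le> \<psi> (fst q *v x + snd q) * w x"
    using le[of x] bump_onD(5,7)[OF w, of x] by (cases "x \<in> P") (auto intro: mult_right_mono)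
qed (use affine_energy_integrable[OF w] \<phi> in auto)

lemma affine_energy_agree:
  fixes \<phi> \<psi> :: "real^'n \<Rightarrow> real" and p q :: "(real^'n^'n) \<times> (real^'n)"
  assumes w: "bump_on P w" and \<phi>: "continuous_on UNIV \<phi>" "continuous_on UNIV \<psi>"
    and le: "\<And>x. x \<in> P \<Longrightarrow> \<phi> (fst p *v x + snd p) \<le> \<psi> (fst q *v x + snd q)"
    and ge: "affine_energy \<psi> w q \<le> affine_energy \<phi> w p" and x: "x \<in> P"
  shows "\<phi> (fst p *v x + snd p) = \<psi> (fst q *v x + snd q)"
  using continuous_agree_on_convex_body[OF w continuous_on_affine_compose[OF \<phi>(1), of p]
      continuous_on_affine_compose[OF \<phi>(2), of q] le _ x] ge
  by (simp add: affine_energy_def)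

text \<open>Along a convergent sequence of affine maps the arguments of \<open>\<phi>\<close> stay in a compact set while \<open>x\<close> ranges
  over \<open>P\<close>, so dominated convergence applies.\<close>
lemma continuous_on_affine_energy:
  fixes \<phi> :: "real^'n \<Rightarrow> real"
  assumes w: "bump_on P w" and \<phi>: "continuous_on UNIV \<phi>"
  shows "continuous_on UNIV (affine_energy \<phi> w)"
proof (rule continuous_on_sequentiallyI)
  fix u :: "nat \<Rightarrow> (real^'n^'n) \<times> (real^'n)" and p
  assume u: "u \<longlonglongrightarrow> p"
  let ?a = "\<lambda>q::((real^'n^'n) \<times> (real^'n)) \<times> (real^'n). \<phi> (fst (fst q) *v snd q + snd (fst q))"
  have conta: "continuous_on UNIV ?a"
    by (rule continuous_on_compose2[OF \<phi> continuous_on_affine_map]) simp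
  have "compact (closure (range u) \<times> P)"
    using convergent_imp_bounded[OF u] bump_onD(1)[OF w] by (intro compact_Times) (simp_all add: compact_closure)
  then have "bounded (?a ` (closure (range u) \<times> P))"
    using continuous_on_subset[OF conta] by (intro compact_imp_bounded compact_continuous_image) auto
  then obtain B where bound: "\<forall>y\<in>?a ` (closure (range u) \<times> P). norm y \<le> B"
    unfolding bounded_iff ..
  have B: "\<bar>?a q\<bar> \<le> B" if "q \<in> closure (range u) \<times> P" for q
    using bspec[OF bound imageI[OF that]] by simp
  have "(\<lambda>n. LINT x|lebesgue. \<phi> (fst (u n) *v x + snd (u n)) * w x) \<longlonglongrightarrow>
      (LINT x|lebesgue. \<phi> (fst p *v x + snd p) * w x)"
  proof (rule integral_dominated_convergence[where w="\<lambda>x. B * w x"])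
    show "(\<lambda>x. \<phi> (fst p *v x + snd p) * w x) \<in> borel_measurable lebesgue"
      "\<And>n. (\<lambda>x. \<phi> (fst (u n) *v x + snd (u n)) * w x) \<in> borel_measurable lebesgue"
      using affine_energy_integrable[OF w \<phi>] by blast+
    show "integrable lebesgue (\<lambda>x. B * w x)"
      by (rule bump_on_integrable[OF w]) simp
    show "AE x in lebesgue. (\<lambda>n. \<phi> (fst (u n) *v x + snd (u n)) * w x) \<longlonglongrightarrow> \<phi> (fst p *v x + snd p) * w x"
    proof (rule AE_I2)
      fix x :: "real^'n"
      have "(\<lambda>n. (u n, x)) \<longlonglongrightarrow> (p, x)"
        using u by (intro tendsto_intros)
      then have "(\<lambda>n. ?a (u n, x)) \<longlonglongrightarrow> ?a (p, x)"
        by (rule continuous_on_tendsto_compose[OF conta]) auto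
      then show "(\<lambda>n. \<phi> (fst (u n) *v x + snd (u n)) * w x) \<longlonglongrightarrow> \<phi> (fst p *v x + snd p) * w x"
        by (intro tendsto_intros) simp
    qed
    show "AE x in lebesgue. norm (\<phi> (fst (u n) *v x + snd (u n)) * w x) \<le> B * w x" for n
    proof (rule AE_I2)
      fix x :: "real^'n"
      have "u n \<in> closure (range u)"
        by (intro subsetD[OF closure_subset] rangeI)
      then show "norm (\<phi> (fst (u n) *v x + snd (u n)) * w x) \<le> B * w x"
        using B[of "(u n, x)"] bump_onD(5,7)[OF w, of x]
        by (cases "x \<in> P") (simp_all add: abs_mult mult_right_mono)
    qed
  qed
  then show "(\<lambda>n. affine_energy \<phi> w (u n)) \<longlonglongrightarrow> affine_energy \<phi> w p"
    by (simp add: affine_energy_def)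
qed

lemma matrix_eq_0_if_vanishes_near_0:
  fixes A :: "real^'n^'n"
  assumes "0 \<in> interior P" "\<And>x. x \<in> P \<Longrightarrow> A *v x = 0"
  shows "A = 0"
proof -
  obtain e where e: "0 < e" "cball 0 e \<subseteq> P"
    using assms(1) by (meson mem_interior_cball)
  have "A *v x = 0" for x
  proof -
    have "(e / (norm x + 1)) *\<^sub>R x \<in> P"
      using e by (intro subsetD[OF e(2)]) (simp add: divide_le_eq mult_left_mono add_nonneg_pos)
    from assms(2)[OF this] have "(e / (norm x + 1)) *\<^sub>R (A *v x) = 0"
      by (simp only: matrix_vector_mult_scaleR)
    moreover have "norm x + 1 \<noteq> 0"
      using norm_ge_zero[of x] by linarith
    ultimately show ?thesis
      using e(1) by simp
  qed
  then show ?thesis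
    by (simp add: matrix_eq)
qed

text \<open>With \<open>\<phi>\<close> the Euclidean norm the energy is homogeneous, continuous and positive away from \<open>0\<close>: an affine
  map that vanishes on a neighbourhood of \<open>0\<close> is zero.  Its minimum on the unit sphere is the constant.\<close>
lemma affine_energy_norm_coercive:
  fixes w :: "real^'n \<Rightarrow> real"
  assumes w: "bump_on P w" and P0: "0 \<in> interior P"
  obtains c where "0 < c" "\<And>p. c * norm p \<le> affine_energy norm w p"
proof -
  let ?N = "affine_energy norm w"
  let ?S = "sphere (0::(real^'n^'n) \<times> (real^'n)) 1"
  have cont: "continuous_on UNIV (norm :: real^'n \<Rightarrow> real)"
    by (intro continuous_intros)
  have nn: "0 \<le> ?N p" for p
    unfolding affine_energy_def using bump_onD(5)[OF w] by (intro integral_nonneg_AE) simp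
  have hom: "?N (c *\<^sub>R p) = c * ?N p" if "0 \<le> c" for c p
  proof -
    have "norm (fst (c *\<^sub>R p) *v x + snd (c *\<^sub>R p)) = c * norm (fst p *v x + snd p)" for x
      using that by (simp add: scaleR_matrix_vector_assoc[symmetric] flip: scaleR_add_right)
    then show ?thesis
      unfolding affine_energy_def by (simp add: mult.assoc)
  qed
  have pos: "0 < ?N p" if "p \<noteq> 0" for p
  proof (rule ccontr)
    assume "\<not> 0 < ?N p"
    then have le: "?N p \<le> affine_energy (\<lambda>_. 0) w p"
      by (simp add: affine_energy_def)
    have vanish: "fst p *v x + snd p = 0" if "x \<in> P" for x
      using affine_energy_agree[OF w _ cont _ le that] by simp
    have "0 \<in> P"
      using P0 interior_subset by blast
    then have "snd p = 0"
      using vanish[of 0] by simp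
    then have "fst p = 0"
      using vanish P0 by (intro matrix_eq_0_if_vanishes_near_0) auto
    then show False
      using \<open>snd p = 0\<close> that by (simp add: prod_eq_iff)
  qed
  have "?S \<noteq> {}"
    by (simp add: sphere_eq_empty)
  then obtain z where z: "z \<in> ?S" "\<And>p. p \<in> ?S \<Longrightarrow> ?N z \<le> ?N p"
    using continuous_attains_inf[OF compact_sphere _ continuous_on_subset[OF continuous_on_affine_energy[OF w cont]], of 0 1]
    by blast
  show ?thesis
  proof
    show "0 < ?N z"
      using z(1) by (intro pos) auto
    show "?N z * norm p \<le> ?N p" for p
    proof (cases "p = 0")
      case True
      then show ?thesis
        using nn by simp
    next
      case False
      then have "?N z \<le> ?N (sgn p)"
        by (intro z(2)) (simp add: norm_sgn)
      also have "\<dots> = ?N p / norm p"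
        using hom[of "1 / norm p" p] by (simp add: sgn_div_norm divide_inverse mult.commute)
      finally show ?thesis
        using False by (simp add: le_divide_eq)
    qed
  qed
qed

section \<open>Minimizers of radial energies\<close>

definition radial_profile :: "real \<Rightarrow> (real \<Rightarrow> real) \<Rightarrow> bool" where
  "radial_profile r F \<longleftrightarrow> convex_on UNIV F \<and> (\<forall>s\<le>r. F s = 0) \<and> strict_mono_on {r..} F"

lemma radial_profile_strict:
  assumes F: "radial_profile r F" and "s < t" "r < t"
  shows "F s < F t"
proof -
  have sm: "strict_mono_on {r..} F" and z: "\<And>s. s \<le> r \<Longrightarrow> F s = 0"
    using F by (auto simp: radial_profile_def)
  have "F s = F (max s r)"
    using z[of s] z[of r] by (cases "s \<le> r") (auto simp: max_def)
  also have "\<dots> < F t"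
    using assms by (intro strict_mono_onD[OF sm]) auto
  finally show ?thesis .
qed

lemma radial_profile_mono:
  assumes F: "radial_profile r F" and "s \<le> t"
  shows "F s \<le> F t"
proof (cases "r < t \<and> s < t")
  case True
  then show ?thesis
    using radial_profile_strict[OF F] by (simp add: less_imp_le)
next
  case False
  then have "s = t \<or> F s = F t"
    using F assms(2) by (auto simp: radial_profile_def)
  then show ?thesis
    by auto
qed

lemma radial_profile_nonneg:
  assumes F: "radial_profile r F"
  shows "0 \<le> F s"
  using radial_profile_mono[OF F, of "min s r" s] F by (auto simp: radial_profile_def)

lemma radial_profile_pos: "radial_profile r F \<Longrightarrow> r < s \<Longrightarrow> 0 < F s"
  using radial_profile_strict[of r F r s] by (auto simp: radial_profile_def)

lemma radial_profile_continuous_norm: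
  assumes F: "radial_profile r F"
  shows "continuous_on UNIV (\<lambda>y::real^'n. F (norm y))"
proof -
  have "continuous_on UNIV F"
    using F by (intro convex_on_continuous) (auto simp: radial_profile_def)
  then show ?thesis
    by (rule continuous_on_compose2) (auto intro!: continuous_intros)
qed

lemma radial_profile_midpoint:
  fixes a b :: "real^'n"
  assumes F: "radial_profile r F"
  shows "F (norm ((1/2) *\<^sub>R (a + b))) \<le> (F (norm a) + F (norm b)) / 2"
proof -
  have "F (norm ((1/2) *\<^sub>R (a + b))) \<le> F ((1 - 1/2) * norm a + (1/2) * norm b)"
    using norm_triangle_ineq[of a b] by (intro radial_profile_mono[OF F]) simp
  also have "\<dots> \<le> (1 - 1/2) * F (norm a) + (1/2) * F (norm b)"
    using F convex_onD[of UNIV F "1/2" "norm a" "norm b"] by (simp add: radial_profile_def)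
  finally show ?thesis
    by simp
qed

lemma affine_energy_midpoint:
  fixes p q :: "(real^'n^'n) \<times> (real^'n)"
  assumes w: "bump_on P w" and F: "radial_profile r F"
  shows "affine_energy (\<lambda>y. F (norm y)) w ((1/2) *\<^sub>R (p + q))
    \<le> (affine_energy (\<lambda>y. F (norm y)) w p + affine_energy (\<lambda>y. F (norm y)) w q) / 2"
proof -
  let ?\<phi> = "\<lambda>y::real^'n. F (norm y)"
  note int = affine_energy_integrable[OF w radial_profile_continuous_norm[OF F]]
  have "affine_energy ?\<phi> w ((1/2) *\<^sub>R (p + q))
      \<le> (LINT x|lebesgue. (?\<phi> (fst p *v x + snd p) * w x + ?\<phi> (fst q *v x + snd q) * w x) / 2)"
    unfolding affine_energy_def
  proof (rule integral_mono)
    fix x :: "real^'n"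
    have "fst ((1/2) *\<^sub>R (p + q)) *v x + snd ((1/2) *\<^sub>R (p + q))
        = (1/2) *\<^sub>R ((fst p *v x + snd p) + (fst q *v x + snd q))"
      by (simp add: scaleR_matrix_vector_assoc[symmetric] matrix_vector_mult_add_rdistrib algebra_simps)
    then show "?\<phi> (fst ((1/2) *\<^sub>R (p + q)) *v x + snd ((1/2) *\<^sub>R (p + q))) * w x
        \<le> (?\<phi> (fst p *v x + snd p) * w x + ?\<phi> (fst q *v x + snd q) * w x) / 2"
      using mult_right_mono[OF radial_profile_midpoint[OF F, of "fst p *v x + snd p" "fst q *v x + snd q"]
          bump_onD(5)[OF w, of x]]
      by (simp add: algebra_simps)
  qed (use int in \<open>auto intro!: integrable_divide Bochner_Integration.integrable_add\<close>)
  also have "\<dots> = (affine_energy ?\<phi> w p + affine_energy ?\<phi> w q) / 2"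
    unfolding affine_energy_def using int[of p] int[of q] by simp
  finally show ?thesis .
qed

text \<open>If the image missed the open ball of radius \<open>r\<close>, a unit vector \<open>u\<close> would satisfy \<open>r \<le> u \<bullet> y\<close> on the
  image.  Translating by \<open>- r u\<close> then brings every point closer to the origin, and this lowers
  the energy strictly at the point \<open>x1\<close>, where the profile is increasing.\<close>
lemma affine_energy_minimizer_meets_ball:
  fixes A :: "real^'n^'n"
  assumes w: "bump_on P w" and F: "radial_profile r F" and r: "0 < r"
    and min: "\<And>u. affine_energy (\<lambda>y. F (norm y)) w (A, v) \<le> affine_energy (\<lambda>y. F (norm y)) w (A, u)"
    and x1: "x1 \<in> P" "r < norm (A *v x1 + v)"
  shows "\<exists>x\<in>P. norm (A *v x + v) < r"
proof (rule ccontr)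
  assume far: "\<not> (\<exists>x\<in>P. norm (A *v x + v) < r)"
  let ?W = "(\<lambda>x. A *v x + v) ` P"
  have "?W = (+) v ` (*v) A ` P"
    by (simp add: image_image add.commute)
  then have "convex ?W"
    using bump_onD(2)[OF w] by (simp add: convex_translation convex_linear_image)
  moreover have "ball 0 r \<inter> ?W = {}"
    using far by auto
  ultimately obtain a b where ab: "a \<noteq> 0" "\<forall>x\<in>ball 0 r. a \<bullet> x \<le> b" "\<forall>x\<in>?W. b \<le> a \<bullet> x"
    using separating_hyperplane_sets[of "ball 0 r" ?W] r x1(1) by auto
  define u where "u = sgn a"
  have u: "norm u = 1" "norm a *\<^sub>R u = a"
    using ab(1) by (simp_all add: u_def norm_sgn sgn_div_norm)
  have "closure (ball 0 r) \<subseteq> {x. a \<bullet> x \<le> b}"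
    using ab(2) by (intro closure_minimal closed_halfspace_le) auto
  then have "a \<bullet> (r *\<^sub>R u) \<le> b"
    using r u(1) by (intro subsetD[of "closure (ball 0 r)" "{x. a \<bullet> x \<le> b}", THEN CollectD]) simp_all
  moreover have au: "a \<bullet> y = norm a * (u \<bullet> y)" for y
    using arg_cong[OF u(2), of "\<lambda>z. z \<bullet> y"] by simp
  moreover have "u \<bullet> (r *\<^sub>R u) = r"
    using u(1) by (simp add: norm_eq_1)
  ultimately have rb: "norm a * r \<le> b"
    by metis
  have closer: "norm (A *v x + (v - r *\<^sub>R u)) < norm (A *v x + v)" and out: "r \<le> norm (A *v x + v)"
    if x: "x \<in> P" for x
  proof -
    let ?y = "A *v x + v"
    have "norm a * r \<le> norm a * (u \<bullet> ?y)"
      using ab(3) x rb unfolding au[symmetric] by force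
    then have uy: "r \<le> u \<bullet> ?y"
      using ab(1) by simp
    then show "r \<le> norm ?y"
      using norm_cauchy_schwarz[of u ?y] u(1) by simp
    have uu: "u \<bullet> u = 1"
      using u(1) by (simp add: norm_eq_1)
    have sq: "(norm (z - r *\<^sub>R u))\<^sup>2 = (norm z)\<^sup>2 - 2 * r * (u \<bullet> z) + r * r" for z
      unfolding power2_norm_eq_inner
      by (simp add: inner_diff_left inner_diff_right inner_commute[of z u] uu algebra_simps)
    have "(norm (?y - r *\<^sub>R u))\<^sup>2 \<le> (norm ?y)\<^sup>2 - r * r"
      unfolding sq using mult_left_mono[OF uy, of r] r by simp
    also have "\<dots> < (norm ?y)\<^sup>2"
      using r by simp
    finally have "norm (?y - r *\<^sub>R u) < norm ?y"
      using power2_less_imp_less norm_ge_zero by blast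
    then show "norm (A *v x + (v - r *\<^sub>R u)) < norm ?y"
      by (simp add: algebra_simps)
  qed
  note cont = radial_profile_continuous_norm[OF F]
  have eq: "F (norm (A *v x + (v - r *\<^sub>R u))) = F (norm (A *v x + v))" if "x \<in> P" for x
    using affine_energy_agree[OF w cont cont, of "(A, v - r *\<^sub>R u)" "(A, v)" x]
      radial_profile_mono[OF F] closer min that by (simp add: less_imp_le)
  show False
    using radial_profile_strict[OF F closer[OF x1(1)] x1(2)] eq[OF x1(1)] by simp
qed

text \<open>Both parts use that the midpoint of two minimizers has at most their energy, although its determinant may
  exceed one.  The hypothesis \<open>escape\<close> is what Loewner position provides: no such map squeezes \<open>P\<close>
  into the ball on which the profile vanishes.\<close>
lemma affine_energy_unique_minimizer:
  fixes p q :: "(real^'n^'n) \<times> (real^'n)"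
  assumes w: "bump_on P w" and F: "radial_profile r F" and r: "0 < r"
    and escape: "\<And>A v. A \<in> Sym_pos \<Longrightarrow> 1 \<le> det A \<Longrightarrow> \<exists>x\<in>P. r < norm (A *v x + v)"
    and p: "p \<in> (Sym_pos \<inter> SL) \<times> UNIV" and q: "q \<in> (Sym_pos \<inter> SL) \<times> UNIV"
    and minp: "\<And>z. z \<in> (Sym_pos \<inter> SL) \<times> UNIV \<Longrightarrow>
        affine_energy (\<lambda>y. F (norm y)) w p \<le> affine_energy (\<lambda>y. F (norm y)) w z"
    and minq: "\<And>z. z \<in> (Sym_pos \<inter> SL) \<times> UNIV \<Longrightarrow>
        affine_energy (\<lambda>y. F (norm y)) w q \<le> affine_energy (\<lambda>y. F (norm y)) w z"
  shows "p = q"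
proof -
  let ?E = "affine_energy (\<lambda>y. F (norm y)) w"
  let ?m = "(1/2) *\<^sub>R (p + q)"
  note cont = radial_profile_continuous_norm[OF F]
  obtain A0 v0 A1 v1 where pq: "p = (A0, v0)" "q = (A1, v1)"
    by (metis surj_pair)
  have S: "A0 \<in> Sym_pos" "det A0 = 1" "A1 \<in> Sym_pos" "det A1 = 1"
    using p q by (simp_all add: pq SL_def)
  have "?E p = ?E q"
    using minp[OF q] minq[OF p] by simp
  then have mid: "?E ?m \<le> ?E p"
    using affine_energy_midpoint[OF w F, of p q] by simp
  define A where "A = (1/2) *\<^sub>R (A0 + A1)"
  define v where "v = (1/2) *\<^sub>R (v0 + v1)"
  have m: "?m = (A, v)"
    by (simp add: pq A_def v_def)
  have A: "A \<in> Sym_pos"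
    unfolding A_def by (intro Sym_pos_scaleR Sym_pos_add S) simp
  have "A0 = A1"
  proof (rule ccontr)
    assume "A0 \<noteq> A1"
    then have det: "1 < det A"
      using det_midpoint_gt_1 S unfolding A_def by blast
    \<comment> \<open>The factor that scales the midpoint back to determinant one.\<close>
    define c where "c = 1 / root CARD('n) (det A)"
    have root: "1 < root CARD('n) (det A)"
      using det real_root_gt_1_iff[of "CARD('n)" "det A"] by simp
    then have c: "0 < c" "c < 1"
      by (simp_all add: c_def)
    have "c ^ CARD('n) * det A = 1"
      using det by (simp add: c_def power_divide real_root_pow_pos)
    then have cA: "(c *\<^sub>R A, c *\<^sub>R v) \<in> (Sym_pos \<inter> SL) \<times> UNIV"
      using Sym_pos_scaleR[OF A c(1)] by (simp add: SL_def det_scaleR)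
    have scale: "c *\<^sub>R A *v x + c *\<^sub>R v = c *\<^sub>R (A *v x + v)" for x
      by (simp add: scaleR_matrix_vector_assoc[symmetric] scaleR_add_right)
    have shrink: "norm (c *\<^sub>R y) \<le> norm y" for y :: "real^'n"
      using c by (simp add: mult_left_le_one_le)
    obtain x where x: "x \<in> P" "r < norm (A *v x + v)"
      using escape[OF A, of v] det by auto
    have "F (norm (fst (c *\<^sub>R A, c *\<^sub>R v) *v x + snd (c *\<^sub>R A, c *\<^sub>R v))) = F (norm (fst (A, v) *v x + snd (A, v)))"
    proof (rule affine_energy_agree[OF w cont cont])
      show "?E (A, v) \<le> ?E (c *\<^sub>R A, c *\<^sub>R v)"
        using mid minp[OF cA] by (simp add: m)
      show "F (norm (fst (c *\<^sub>R A, c *\<^sub>R v) *v y + snd (c *\<^sub>R A, c *\<^sub>R v))) \<le> F (norm (fst (A, v) *v y + snd (A, v)))" for y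
        unfolding fst_conv snd_conv scale by (intro radial_profile_mono[OF F] shrink)
    qed (rule x(1))
    then have "F (norm (c *\<^sub>R (A *v x + v))) = F (norm (A *v x + v))"
      by (simp add: scale)
    moreover have "norm (c *\<^sub>R (A *v x + v)) < norm (A *v x + v)"
    proof -
      have "0 < norm (A *v x + v)"
        using x(2) r by linarith
      then have "c * norm (A *v x + v) < 1 * norm (A *v x + v)"
        using c(2) by (rule mult_strict_right_mono[rotated])
      then show ?thesis
        using c(1) by simp
    qed
    ultimately show False
      using radial_profile_strict[OF F _ x(2)] by force
  qed
  then have AA: "A0 = A" "A1 = A"
    unfolding A_def by (simp_all flip: scaleR_2)
  \<comment> \<open>From here on the matrices agree, and the two translations are \<open>v - d\<close> and \<open>v + d\<close>.\<close>
  define d where "d = (1/2) *\<^sub>R (v1 - v0)"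
  have v01: "v0 = v - d" "v1 = v + d"
    by (simp_all add: v_def d_def vec_eq_iff field_simps)
  have AS: "(A, u) \<in> (Sym_pos \<inter> SL) \<times> UNIV" for u
    using p by (simp add: pq AA)
  have min: "?E (A, v) \<le> ?E (A, u)" for u
    using order_trans[OF mid minp[OF AS]] by (simp add: m)
  obtain x1 where x1: "x1 \<in> P" "r < norm (A *v x1 + v)"
    using escape[OF A, of v] S(2) AA by auto
  obtain x0 where x0: "x0 \<in> P" "norm (A *v x0 + v) < r"
    using affine_energy_minimizer_meets_ball[OF w F r min x1] by blast
  have "connected ((\<lambda>x. norm (A *v x + v)) ` P)"
    using bump_onD(2)[OF w] by (intro connected_continuous_image convex_connected continuous_intros)
  then have "r \<in> (\<lambda>x. norm (A *v x + v)) ` P"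
    using x0 x1 by (meson connectedD_interval image_eqI less_imp_le)
  then obtain x where x: "x \<in> P" "norm (A *v x + v) = r"
    by auto
  let ?y = "A *v x + v"
  \<comment> \<open>The midpoint has minimal energy, so the midpoint inequality is an equality throughout \<open>P\<close>.\<close>
  have half: "F (norm (A *v z + v)) = (F (norm (A *v z + v - d)) + F (norm (A *v z + v + d))) / 2" if z: "z \<in> P" for z
  proof -
    let ?\<psi> = "\<lambda>y. (F (norm (y - d)) + F (norm (y + d))) / 2"
    have cont\<psi>: "continuous_on UNIV ?\<psi>"
      by (intro continuous_intros continuous_on_compose2[OF cont]) auto
    have "?E p = affine_energy (\<lambda>y. F (norm (y - d))) w (A, v)" "?E q = affine_energy (\<lambda>y. F (norm (y + d))) w (A, v)"
      by (simp_all add: affine_energy_def pq AA v01 algebra_simps)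
    moreover have "affine_energy ?\<psi> w (A, v)
        = (affine_energy (\<lambda>y. F (norm (y - d))) w (A, v) + affine_energy (\<lambda>y. F (norm (y + d))) w (A, v)) / 2"
    proof -
      have "integrable lebesgue (\<lambda>x. F (norm (A *v x + v - d)) * w x)"
        "integrable lebesgue (\<lambda>x. F (norm (A *v x + v + d)) * w x)"
        using affine_energy_integrable[OF w cont, of "(A, v - d)"] affine_energy_integrable[OF w cont, of "(A, v + d)"]
        by (simp_all add: algebra_simps)
      then show ?thesis
        by (simp add: affine_energy_def ring_distribs add_divide_distrib)
    qed
    ultimately have "affine_energy ?\<psi> w (A, v) \<le> ?E (A, v)"
      using \<open>?E p = ?E q\<close> minp[OF AS[of v]] by simp
    moreover have "F (norm y) \<le> ?\<psi> y" for y
      using radial_profile_midpoint[OF F, of "y - d" "y + d"] by (simp flip: scaleR_2)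
    ultimately show ?thesis
      using affine_energy_agree[OF w cont cont\<psi>, of "(A, v)" "(A, v)" z] z by simp
  qed
  have "F (norm ?y) = 0"
    using F x(2) by (simp add: radial_profile_def)
  then have "F (norm (?y - d)) + F (norm (?y + d)) = 0"
    using half[OF x(1)] by simp
  then have "F (norm (?y - d)) = 0 \<and> F (norm (?y + d)) = 0"
    using add_nonneg_eq_0_iff radial_profile_nonneg[OF F] by blast
  then have "norm (?y - d) \<le> r" "norm (?y + d) \<le> r"
    using radial_profile_pos[OF F] by (metis less_irrefl not_le)+
  then have "(norm (?y - d))\<^sup>2 + (norm (?y + d))\<^sup>2 \<le> r\<^sup>2 + r\<^sup>2"
    by (intro add_mono power_mono) auto
  moreover have "(norm (?y - d))\<^sup>2 + (norm (?y + d))\<^sup>2 = 2 * (norm ?y)\<^sup>2 + 2 * (norm d)\<^sup>2"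
    by (simp add: power2_norm_eq_inner inner_diff_left inner_diff_right inner_add_left inner_add_right inner_commute)
  ultimately have "d = 0"
    using x(2) by simp
  then show ?thesis
    by (simp add: pq AA v01)
qed

lemma affine_energy_minimizer_exists:
  fixes \<phi> :: "real^'n \<Rightarrow> real"
  assumes w: "bump_on P w" and \<phi>: "continuous_on UNIV \<phi>"
    and coercive: "0 < c" "\<And>p. c * norm p - C \<le> affine_energy \<phi> w p"
  obtains p where "p \<in> (Sym_pos \<inter> SL) \<times> UNIV"
    "\<And>z. z \<in> (Sym_pos \<inter> SL) \<times> UNIV \<Longrightarrow> affine_energy \<phi> w p \<le> affine_energy \<phi> w z"
proof -
  let ?E = "affine_energy \<phi> w"
  let ?S = "(Sym_pos \<inter> SL) \<times> (UNIV :: (real^'n) set)"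
  let ?e = "(mat 1, 0) :: (real^'n^'n) \<times> (real^'n)"
  let ?T = "?S \<inter> {z. ?E z \<le> ?E ?e}"
  note cont = continuous_on_affine_energy[OF w \<phi>]
  have e: "?e \<in> ?T"
    by (simp add: SL_def)
  have "norm z \<le> (?E ?e + C) / c" if "z \<in> ?T" for z
    using that coercive(2)[of z] coercive(1) by (auto simp: le_divide_eq mult.commute)
  then have "bounded ?T"
    unfolding bounded_iff by blast
  moreover have "closed ?T"
    by (intro closed_Int closed_Times closed_Sym_pos_SL closed_Collect_le cont continuous_on_const closed_UNIV)
  ultimately have "compact ?T"
    by (simp add: compact_eq_bounded_closed)
  then obtain p where p: "p \<in> ?T" "\<And>z. z \<in> ?T \<Longrightarrow> ?E p \<le> ?E z"
    using continuous_attains_inf[of ?T ?E] e continuous_on_subset[OF cont subset_UNIV] by blast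
  show ?thesis
  proof
    show "p \<in> ?S"
      using p(1) by simp
    show "?E p \<le> ?E z" if "z \<in> ?S" for z
      using p that by (cases "?E z \<le> ?E ?e") (auto simp: not_le intro: less_imp_le order_trans)
  qed
qed

section \<open>Lower bounds, accumulation points and substitution\<close>

definition excess :: "real^'n \<Rightarrow> real" where
  "excess y = max 0 (norm y - 1)"

lemma continuous_on_excess: "continuous_on UNIV (excess :: real^'n \<Rightarrow> real)"
  unfolding excess_def by (intro continuous_intros)

text \<open>Truncating the norm at \<open>1\<close> costs at most the integral of the weight.\<close>
lemma excess_energy_coercive:
  fixes w :: "real^'n \<Rightarrow> real"
  assumes w: "bump_on P w" and P0: "0 \<in> interior P"
  obtains c C where "0 < c" "\<And>p. c * norm p - C \<le> affine_energy excess w p"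
proof -
  have cont: "continuous_on UNIV (norm :: real^'n \<Rightarrow> real)"
    by (intro continuous_intros)
  obtain c where c: "0 < c" "\<And>p. c * norm p \<le> affine_energy norm w p"
    using affine_energy_norm_coercive[OF w P0] by blast
  have iw: "integrable lebesgue w"
    using bump_on_integrable[OF w, of "\<lambda>_. 1"] by simp
  have "affine_energy norm w p \<le> affine_energy (\<lambda>y. excess y + 1) w p" for p
    by (rule affine_energy_mono[OF w cont])
      (auto simp: excess_def intro!: continuous_intros continuous_on_excess)
  also have "affine_energy (\<lambda>y. excess y + 1) w p = affine_energy excess w p + (LINT x|lebesgue. w x)" for p
    using affine_energy_integrable[OF w continuous_on_excess, of p] iw
    by (simp add: affine_energy_def ring_distribs)
  finally have "c * norm p - (LINT x|lebesgue. w x) \<le> affine_energy excess w p" for p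
    using c(2)[of p] by (simp add: order_trans algebra_simps)
  then show ?thesis
    using that c(1) by blast
qed

text \<open>This replaces the passage to convergent subsequences when a limit is identified by compactness.\<close>
lemma eventually_notin_compact:
  assumes "compact Z" "\<And>q. q \<in> Z \<Longrightarrow> \<exists>U. open U \<and> q \<in> U \<and> eventually (\<lambda>r. x r \<notin> U) F"
  shows "eventually (\<lambda>r. x r \<notin> Z) F"
proof -
  obtain U where U: "\<And>q. q \<in> Z \<Longrightarrow> open (U q) \<and> q \<in> U q \<and> eventually (\<lambda>r. x r \<notin> U q) F"
    using assms(2) by metis
  obtain Q where Q: "Q \<subseteq> Z" "finite Q" "Z \<subseteq> (\<Union>q\<in>Q. U q)"
    using compactE_image[OF assms(1), of Z U] U by blast
  have "eventually (\<lambda>r. \<forall>q\<in>Q. x r \<notin> U q) F"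
    using Q U by (intro eventually_ball_finite) auto
  then show ?thesis
    by (rule eventually_mono) (use Q(3) in blast)
qed

text \<open>It suffices to compare boxes, whose preimages are affine images under the inverse map.\<close>
lemma lborel_affine_unimodular:
  fixes A :: "real^'n^'n"
  assumes "det A = 1"
  shows "distr lborel borel (\<lambda>x. A *v x + v) = lborel"
proof (rule sym, rule lborel_eqI)
  fix l u :: "real^'n"
  assume lu: "\<And>b. b \<in> Basis \<Longrightarrow> l \<bullet> b \<le> u \<bullet> b"
  obtain B where B: "A ** B = mat 1" "B ** A = mat 1"
    using assms invertible_det_nz[of A] unfolding invertible_def by auto
  have "det B = 1"
    using arg_cong[OF B(1), of det] assms by (simp add: det_mul)
  define h where "h = (\<lambda>y. B *v y + (- (B *v v)))"
  have hf: "h (A *v x + v) = x" "A *v h x + v = x" for x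
    using B by (simp_all add: h_def matrix_vector_right_distrib matrix_vector_mult_diff_distrib matrix_vector_mul_assoc)
  have vimage: "(\<lambda>x. A *v x + v) -` box l u = h ` box l u"
    using hf by (auto simp: image_iff) metis
  have meas: "(\<lambda>x. A *v x + v) \<in> borel_measurable borel"
    by (intro borel_measurable_continuous_onI continuous_intros)
  have Sb: "h ` box l u \<in> sets borel"
    using measurable_sets[OF meas, of "box l u"] by (simp add: vimage)
  have m: "measure lebesgue (h ` box l u) = measure lebesgue (box l u)"
    using measure_affine_image[of "box l u" B "- (B *v v)"] \<open>det B = 1\<close> by (simp add: h_def)
  have split: "h ` box l u = (+) (- (B *v v)) ` (*v) B ` box l u"
    by (simp add: h_def image_image)
  have "(*v) B ` box l u \<in> lmeasurable"
    using measure_linear_image_finite[OF matrix_vector_mul_linear, of "box l u" B] by simp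
  then have "h ` box l u \<in> lmeasurable"
    unfolding split by (rule measurable_translation)
  then have "emeasure lebesgue (h ` box l u) = emeasure lebesgue (box l u)"
    using m by (simp add: emeasure_eq_measure2)
  then have "emeasure lborel (h ` box l u) = emeasure lborel (box l u)"
    using Sb by simp
  then show "emeasure (distr lborel borel (\<lambda>x. A *v x + v)) (box l u) = (\<Prod>b\<in>Basis. (u - l) \<bullet> b)"
    using lu meas by (simp add: emeasure_distr vimage emeasure_lborel_box)
qed simp

lemma lebesgue_integral_affine_unimodular:
  fixes A :: "real^'n^'n" and h :: "real^'n \<Rightarrow> real"
  assumes A: "det A = 1" and h: "h \<in> borel_measurable borel"
  shows "(LINT x|lebesgue. h (A *v x + v)) = (LINT x|lebesgue. h x)"
proof -
  have meas: "(\<lambda>x. A *v x + v) \<in> borel_measurable borel"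
    by (intro borel_measurable_continuous_onI continuous_intros)
  have "(LINT x|lebesgue. h (A *v x + v)) = (LINT x|lborel. h (A *v x + v))"
    using h measurable_compose[OF meas h] by (intro integral_completion) simp
  also have "\<dots> = (LINT x|distr lborel borel (\<lambda>x. A *v x + v). h x)"
    using meas h by (intro integral_distr[symmetric]) simp_all
  also have "\<dots> = (LINT x|lebesgue. h x)"
    using h by (simp add: lborel_affine_unimodular[OF A] integral_completion)
  finally show ?thesis .
qed

lemma unique_minimum_on_iff:
  "unique_minimum_on F S p \<longleftrightarrow>
     p \<in> S \<and> (\<forall>z\<in>S. F p \<le> F z) \<and> (\<forall>q\<in>S. (\<forall>z\<in>S. F q \<le> F z) \<longrightarrow> q = p)"
  unfolding unique_minimum_on_def is_arg_min_def by (auto simp: not_less)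

lemma unique_minimum_on_image:
  assumes "unique_minimum_on F S p" "\<And>z. z \<in> S \<Longrightarrow> F' (T z) = F z"
  shows "unique_minimum_on F' (T ` S) (T p)"
  using assms unfolding unique_minimum_on_iff by simp

text \<open>The slope of the chord of \<open>f\<close> from \<open>-1\<close>, where \<open>f\<close> vanishes, to \<open>0\<close> is \<open>f 0\<close>; beyond \<open>0\<close> a convex
  function stays above this chord.\<close>
lemma convex_profile_lower_bound:
  fixes f :: "real \<Rightarrow> real"
  assumes f: "convex_on UNIV f" "\<forall>x\<le>-1. f x = 0" and nonneg: "\<And>s. 0 \<le> f s"
  shows "f 0 * max 0 s \<le> f s"
proof (cases "0 \<le> s")
  case True
  have "f ((1 - 1 / (s + 1)) *\<^sub>R (-1) + (1 / (s + 1)) *\<^sub>R s)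
      \<le> (1 - 1 / (s + 1)) * f (-1) + (1 / (s + 1)) * f s"
    using True by (intro convex_onD[OF f(1)]) (auto simp: divide_le_eq)
  moreover have "(1 - 1 / (s + 1)) *\<^sub>R (-1) + (1 / (s + 1)) *\<^sub>R s = 0"
    using True by (simp add: field_simps)
  ultimately have "f 0 \<le> f s / (s + 1)"
    using f(2) by simp
  then have "f 0 * (s + 1) \<le> f s"
    using True by (simp add: le_divide_eq)
  then have "f 0 * s + f 0 \<le> f s"
    by (simp add: algebra_simps)
  then show ?thesis
    using True nonneg[of 0] by (simp add: max_def)
next
  case False
  then show ?thesis
    using nonneg by (simp add: max_def)
qed

lemma radial_profile_rescale:
  assumes f: "convex_on UNIV f" "\<forall>x\<le>-1. f x = 0" "strict_mono_on {-1..} f" and r: "r < 1"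
  shows "radial_profile r (rescale r f)"
proof -
  have "convex_on UNIV (rescale r f)"
  proof (rule convex_onI)
    fix t x y :: real
    assume t: "0 < t" "t < 1"
    have "((1 - t) *\<^sub>R x + t *\<^sub>R y - 1) / (1 - r) = (1 - t) *\<^sub>R ((x - 1) / (1 - r)) + t *\<^sub>R ((y - 1) / (1 - r))"
      by (simp add: add_divide_distrib[symmetric] algebra_simps)
    then show "rescale r f ((1 - t) *\<^sub>R x + t *\<^sub>R y) \<le> (1 - t) * rescale r f x + t * rescale r f y"
      using convex_onD[OF f(1), of t "(x - 1) / (1 - r)" "(y - 1) / (1 - r)"] t
      by (simp add: rescale_def)
  qed simp
  moreover have "rescale r f s = 0" if "s \<le> r" for s
    using f(2) that r by (simp add: rescale_def divide_le_eq)
  moreover have "strict_mono_on {r..} (rescale r f)"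
  proof (rule strict_mono_onI)
    fix s t :: real
    assume "s \<in> {r..}" "t \<in> {r..}" "s < t"
    then show "rescale r f s < rescale r f t"
      using r unfolding rescale_def
      by (intro strict_mono_onD[OF f(3)]) (auto simp: le_divide_eq divide_strict_right_mono)
  qed
  ultimately show ?thesis
    by (simp add: radial_profile_def)
qed

section \<open>The functionals of a body in Loewner position\<close>

locale loewner_body =
  fixes K :: "(real^'n) set" and f g :: "real \<Rightarrow> real"
  assumes body: "convex_body K" and loewner: "loewner_position K"
    and f: "convex_on UNIV f" "\<forall>x\<le>-1. f x = 0" "strict_mono_on {-1..} f"
    and g: "antimono g" "\<forall>x\<le>-1. g x = 1" "\<forall>x\<in>{-1<..<1}. 0 < g x" "\<forall>x\<ge>1. g x = 0"
begin

definition weight :: "real \<Rightarrow> real^'n \<Rightarrow> real" where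
  "weight r x = rescale r g (gauge_function K x)"

definition energy :: "real \<Rightarrow> (real^'n^'n) \<times> (real^'n) \<Rightarrow> real" where
  "energy r = affine_energy (\<lambda>y. rescale r f (norm y)) (weight r)"

abbreviation dilate :: "real \<Rightarrow> (real^'n) set" where
  "dilate c \<equiv> (\<lambda>x. c *\<^sub>R x) ` K"

abbreviation domain :: "((real^'n^'n) \<times> (real^'n)) set" where
  "domain \<equiv> (Sym_pos \<inter> SL) \<times> UNIV"

lemma zero_interior: "0 \<in> interior K"
  by (rule loewner_0_in_interior[OF body loewner])

lemma zero_mem: "0 \<in> K"
  using zero_interior interior_subset by blast

lemma convex_K: "convex K"
  using body by (simp add: convex_body_def)

lemma bump_weight: "0 < r \<Longrightarrow> r < 1 \<Longrightarrow> bump_on (dilate (2 - r)) (weight r)"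
  unfolding weight_def by (rule bump_on_gauge_weight[OF body zero_interior g])

lemma bump_dilate: "0 < c \<Longrightarrow> bump_on (dilate c) (indicator (dilate c))"
  by (intro bump_on_indicator convex_body_scaling body)

lemma zero_interior_dilate: "0 < c \<Longrightarrow> 0 \<in> interior (dilate c)"
  using zero_interior by (auto simp: interior_scaling_image intro!: image_eqI[of _ _ 0])

lemma profile: "r < 1 \<Longrightarrow> radial_profile r (rescale r f)"
  by (rule radial_profile_rescale[OF f])

lemma f_nonneg: "0 \<le> f s"
proof -
  have "radial_profile (-1) f"
    using f by (simp add: radial_profile_def)
  then show ?thesis
    by (rule radial_profile_nonneg)
qed

lemma f_0_pos: "0 < f 0"
  using strict_mono_onD[OF f(3), of "-1" 0] f(2) by simp

text \<open>Otherwise \<open>(2 - r) / r\<close> times the map would send \<open>K\<close> into the unit ball, with determinant greater than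
  one.\<close>
lemma image_leaves_ball:
  assumes r: "0 < r" "r < 1" and A: "A \<in> Sym_pos" "1 \<le> det A"
  shows "\<exists>x\<in>dilate (2 - r). r < norm (A *v x + v)"
proof (rule ccontr)
  assume "\<not> ?thesis"
  then have inside: "norm (A *v ((2 - r) *\<^sub>R x) + v) \<le> r" if "x \<in> K" for x
    using that by (auto simp: not_less)
  let ?c = "(2 - r) / r"
  have "?c *\<^sub>R A *v x + (1 / r) *\<^sub>R v = (1 / r) *\<^sub>R (A *v ((2 - r) *\<^sub>R x) + v)" for x
    by (simp add: scaleR_matrix_vector_assoc[symmetric] matrix_vector_mult_scaleR scaleR_add_right)
  then have "norm (?c *\<^sub>R A *v x + (1 / r) *\<^sub>R v) \<le> 1" if "x \<in> K" for x
    using inside[OF that] r by (simp add: divide_le_eq)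
  then have "\<bar>det (?c *\<^sub>R A)\<bar> \<le> 1"
    by (intro loewner_affine_image(1)[OF loewner, of _ "(1 / r) *\<^sub>R v"]) auto
  moreover have "1 < ?c"
    using r by (simp add: less_divide_eq)
  then have "1 < ?c ^ CARD('n)"
    by (intro one_less_power) auto
  then have "1 < det (?c *\<^sub>R A)"
    unfolding det_scaleR using A(2) less_1_mult'[of "?c ^ CARD('n)" "det A"] by blast
  ultimately show False
    by simp
qed

text \<open>The weight is \<open>1\<close> on \<open>\<rho> K\<close>.  The factor \<open>1 / (1 - r)\<close> is what makes the excess of the minimizers
  vanish in the limit.\<close>
lemma energy_lower_bound:
  assumes \<rho>: "0 < \<rho>" "\<rho> \<le> r" and r: "r < 1"
  shows "f 0 / (1 - r) * affine_energy excess (indicator (dilate \<rho>)) p \<le> energy r p"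
proof -
  have r0: "0 < r"
    using \<rho> by simp
  have "f 0 / (1 - r) * affine_energy excess (indicator (dilate \<rho>)) p
      = (LINT x|lebesgue. f 0 / (1 - r) * (excess (fst p *v x + snd p) * indicator (dilate \<rho>) x))"
    by (simp add: affine_energy_def)
  also have "\<dots> \<le> energy r p"
    unfolding energy_def affine_energy_def
  proof (rule integral_mono)
    show "integrable lebesgue (\<lambda>x. f 0 / (1 - r) * (excess (fst p *v x + snd p) * indicator (dilate \<rho>) x))"
      by (intro integrable_mult_right affine_energy_integrable[OF bump_dilate[OF \<rho>(1)] continuous_on_excess])
    show "integrable lebesgue (\<lambda>x. rescale r f (norm (fst p *v x + snd p)) * weight r x)"
      by (rule affine_energy_integrable[OF bump_weight[OF r0 r] radial_profile_continuous_norm[OF profile[OF r]]])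
    fix x :: "real^'n"
    let ?y = "fst p *v x + snd p"
    have nn: "0 \<le> rescale r f (norm ?y)" "0 \<le> weight r x"
      using bump_onD(5)[OF bump_weight[OF r0 r]] f_nonneg by (simp_all add: rescale_def)
    show "f 0 / (1 - r) * (excess ?y * indicator (dilate \<rho>) x) \<le> rescale r f (norm ?y) * weight r x"
    proof (cases "x \<in> dilate \<rho>")
      case True
      then have "x \<in> dilate r"
        using scaling_subset[OF convex_K zero_mem, of \<rho> r] \<rho> by auto
      then have "weight r x = 1"
        unfolding weight_def by (rule gauge_weight_eq_1[OF g(2) r0 r])
      moreover have "f 0 / (1 - r) * excess ?y = f 0 * max 0 ((norm ?y - 1) / (1 - r))"
        using r by (simp add: excess_def max_def zero_le_divide_iff)
      moreover have "\<dots> \<le> rescale r f (norm ?y)"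
        unfolding rescale_def by (rule convex_profile_lower_bound[OF f(1,2) f_nonneg])
      ultimately show ?thesis
        using True by simp
    qed (use nn in simp)
  qed
  finally show ?thesis .
qed

text \<open>On the support of the weight \<open>|x| \<le> 2 - r\<close>, where \<open>f\<close> is evaluated at arguments at most \<open>1\<close>.  This bound
  does not depend on \<open>r\<close>.\<close>
lemma energy_identity_upper_bound:
  assumes r: "0 < r" "r < 1"
  shows "energy r (mat 1, 0) \<le> f 1 * measure lebesgue (cball (0::real^'n) 2)"
proof -
  let ?e = "(mat 1, 0) :: (real^'n^'n) \<times> (real^'n)"
  note w = bump_weight[OF r]
  have "energy r ?e \<le> (LINT x|lebesgue. f 1 * indicator (cball (0::real^'n) 2) x)"
    unfolding energy_def affine_energy_def
  proof (rule integral_mono)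
    show "integrable lebesgue (\<lambda>x. rescale r f (norm (fst ?e *v x + snd ?e)) * weight r x)"
      by (rule affine_energy_integrable[OF w radial_profile_continuous_norm[OF profile[OF r(2)]]])
    show "integrable lebesgue (\<lambda>x. f 1 * indicator (cball (0::real^'n) 2) x)"
      by (intro integrable_mult_right integrable_real_indicator) (use lmeasurable_cball[of "0::real^'n" 2] in \<open>auto simp: fmeasurable_def\<close>)
    fix x :: "real^'n"
    show "rescale r f (norm (fst ?e *v x + snd ?e)) * weight r x
        \<le> f 1 * indicator (cball 0 2) x"
    proof (cases "x \<in> dilate (2 - r)")
      case True
      then obtain y where y: "y \<in> K" "x = (2 - r) *\<^sub>R y"
        by auto
      then have "norm y \<le> 1"
        using loewner_subset_cball[OF loewner] by auto
      then have nx: "norm x \<le> 2 - r"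
        using r mult_left_mono[of "norm y" 1 "2 - r"] by (simp add: y(2))
      have "rescale r f (norm x) \<le> rescale r f (2 - r)"
        by (rule radial_profile_mono[OF profile[OF r(2)] nx])
      also have "\<dots> = f 1"
        using r by (simp add: rescale_def)
      finally have "rescale r f (norm x) * weight r x \<le> f 1 * 1"
        using bump_onD(5,6)[OF w, of x] f_nonneg by (intro mult_mono) auto
      then show ?thesis
        using nx r by simp
    qed (use bump_onD(7)[OF w] f_nonneg in simp)
  qed
  also have "\<dots> = f 1 * measure lebesgue (cball (0::real^'n) 2)"
    by simp
  finally show ?thesis .
qed

lemma mat_1_in_domain: "(mat 1, 0) \<in> domain"
  by (simp add: SL_def)

lemma energy_unique_minimizer:
  assumes r: "1/2 < r" "r < 1"
  shows "\<exists>!p. p \<in> domain \<and> (\<forall>z\<in>domain. energy r p \<le> energy r z)"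
proof -
  have r0: "0 < r"
    using r by simp
  note w = bump_weight[OF r0 r(2)] and F = profile[OF r(2)]
  obtain c C where c: "0 < c" "\<And>p. c * norm p - C \<le> affine_energy excess (indicator (dilate (1/2))) p"
    using excess_energy_coercive[OF bump_dilate[of "1/2"] zero_interior_dilate[of "1/2"]] by auto
  define a where "a = f 0 / (1 - r)"
  have a: "0 < a"
    using f_0_pos r by (simp add: a_def)
  have coercive: "(a * c) * norm p - a * C \<le> energy r p" for p
  proof -
    have "(a * c) * norm p - a * C \<le> a * affine_energy excess (indicator (dilate (1/2))) p"
      using mult_left_mono[OF c(2)[of p], of a] a by (simp add: algebra_simps)
    also have "\<dots> \<le> energy r p"
      unfolding a_def using r by (intro energy_lower_bound) auto
    finally show ?thesis .
  qed
  obtain p where p: "p \<in> domain" "\<And>z. z \<in> domain \<Longrightarrow> energy r p \<le> energy r z"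
    using affine_energy_minimizer_exists[OF w radial_profile_continuous_norm[OF F]
        mult_pos_pos[OF a c(1)] coercive[unfolded energy_def]]
    unfolding energy_def by blast
  have "q = p" if "q \<in> domain" "\<forall>z\<in>domain. energy r q \<le> energy r z" for q
    by (rule affine_energy_unique_minimizer[OF w F r0 image_leaves_ball[OF r0 r(2)] that(1) p(1)])
      (use that(2) p(2) in \<open>simp_all only: energy_def[symmetric]\<close>)
  then show ?thesis
    using p by (intro ex1I[of _ p]) blast+
qed

definition minimizer :: "real \<Rightarrow> (real^'n^'n) \<times> (real^'n)" where
  "minimizer r = (THE p. p \<in> domain \<and> (\<forall>z\<in>domain. energy r p \<le> energy r z))"

lemma minimizer:
  assumes "1/2 < r" "r < 1"
  shows "minimizer r \<in> domain" "z \<in> domain \<Longrightarrow> energy r (minimizer r) \<le> energy r z"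
    "q \<in> domain \<Longrightarrow> (\<And>z. z \<in> domain \<Longrightarrow> energy r q \<le> energy r z) \<Longrightarrow> q = minimizer r"
proof -
  have min: "minimizer r \<in> domain \<and> (\<forall>z\<in>domain. energy r (minimizer r) \<le> energy r z)"
    unfolding minimizer_def by (rule theI'[OF energy_unique_minimizer[OF assms]])
  then show "minimizer r \<in> domain" "z \<in> domain \<Longrightarrow> energy r (minimizer r) \<le> energy r z"
    by blast+
  show "q = minimizer r" if "q \<in> domain" "\<And>z. z \<in> domain \<Longrightarrow> energy r q \<le> energy r z"
    using ex1_implies_ex[OF energy_unique_minimizer[OF assms]] min that
      energy_unique_minimizer[OF assms, THEN ex1E] by metis
qed

lemma excess_energy_minimizer_bound:
  assumes \<rho>: "0 < \<rho>" "\<rho> \<le> r" and r: "1/2 < r" "r < 1"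
  shows "affine_energy excess (indicator (dilate \<rho>)) (minimizer r)
    \<le> (1 - r) * (f 1 * measure lebesgue (cball (0::real^'n) 2) / f 0)"
proof -
  have "f 0 / (1 - r) * affine_energy excess (indicator (dilate \<rho>)) (minimizer r) \<le> energy r (minimizer r)"
    by (rule energy_lower_bound[OF \<rho> r(2)])
  also have "\<dots> \<le> energy r (mat 1, 0)"
    by (rule minimizer(2)[OF r mat_1_in_domain])
  also have "\<dots> \<le> f 1 * measure lebesgue (cball (0::real^'n) 2)"
    using r by (intro energy_identity_upper_bound) auto
  finally show ?thesis
    using r f_0_pos by (simp add: field_simps)
qed

text \<open>If the excess vanished for every \<open>\<rho> < 1\<close>, the map would send every \<open>\<rho> K\<close>, and in the limit \<open>K\<close>, into
  the unit ball; the Loewner ellipsoid is unique, so the map would be the identity.\<close>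
lemma excess_energy_pos:
  assumes q: "q \<in> domain" "q \<noteq> (mat 1, 0)"
  shows "\<exists>\<rho>\<in>{0<..<1}. 0 < affine_energy excess (indicator (dilate \<rho>)) q"
proof (rule ccontr)
  assume none: "\<not> ?thesis"
  obtain A v where Av: "q = (A, v)"
    by (metis surj_pair)
  then have A: "A \<in> Sym_pos" "det A = 1"
    using q(1) by (simp_all add: SL_def)
  have inner: "norm (A *v (\<rho> *\<^sub>R x) + v) \<le> 1" if \<rho>: "0 < \<rho>" "\<rho> < 1" and x: "x \<in> K" for \<rho> x
  proof -
    have "affine_energy excess (indicator (dilate \<rho>)) q \<le> affine_energy (\<lambda>_. 0) (indicator (dilate \<rho>)) q"
      using none \<rho> by (auto simp: affine_energy_def not_less)
    moreover have "\<rho> *\<^sub>R x \<in> dilate \<rho>"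
      using x by blast
    ultimately have "0 = excess (A *v (\<rho> *\<^sub>R x) + v)"
      using affine_energy_agree[OF bump_dilate[OF \<rho>(1)] _ continuous_on_excess, of "\<lambda>_. 0" q q "\<rho> *\<^sub>R x"]
      by (simp add: excess_def Av)
    then show ?thesis
      by (simp add: excess_def max_def split: if_splits)
  qed
  have "norm (A *v x + v) \<le> 1" if x: "x \<in> K" for x
  proof -
    have "((\<lambda>\<rho>::real. norm (\<rho> *\<^sub>R (A *v x) + v)) \<longlongrightarrow> norm (1 *\<^sub>R (A *v x) + v)) (at_left 1)"
      by (intro tendsto_intros)
    moreover have "eventually (\<lambda>\<rho>. norm (\<rho> *\<^sub>R (A *v x) + v) \<le> 1) (at_left (1::real))"
      using eventually_at_left_real[of 0 "1::real"]
      by (rule eventually_mono) (use inner[OF _ _ x] in \<open>auto simp: matrix_vector_mult_scaleR\<close>)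
    ultimately have "norm (1 *\<^sub>R (A *v x) + v) \<le> 1"
      by (rule tendsto_upperbound) simp
    then show ?thesis
      by simp
  qed
  then have "(\<lambda>x. A *v x + v) ` K \<subseteq> cball 0 1"
    by auto
  then have "(\<lambda>x. A *v x + v) ` cball 0 1 = cball 0 1"
    using A(2) by (intro loewner_affine_image(2)[OF loewner]) auto
  then have "A = mat 1 \<and> v = 0"
    by (intro Sym_pos_maps_cball_into_cball A) simp
  then show False
    using q(2) Av by simp
qed

text \<open>Outside a neighbourhood of the identity, the bounded region in which the minimizers live is compact.
  Near each of its points some excess energy exceeds a positive constant, while at the minimizers it tends
  to \<open>0\<close>.\<close>
lemma minimizer_tendsto: "(minimizer \<longlongrightarrow> (mat 1, 0)) (at_left 1)"
proof (rule topological_tendstoI)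
  fix U :: "((real^'n^'n) \<times> (real^'n)) set"
  assume U: "open U" "(mat 1, 0) \<in> U"
  define B where "B = f 1 * measure lebesgue (cball (0::real^'n) 2) / f 0"
  have B: "0 \<le> B"
    using f_nonneg f_0_pos by (simp add: B_def)
  note bound = excess_energy_minimizer_bound[folded B_def]
  have near: "eventually (\<lambda>r. r \<in> {s<..<1}) (at_left (1::real))" if "s < 1" for s
    using that by (rule eventually_at_left_real)
  obtain c C where c: "0 < c" "\<And>p. c * norm p - C \<le> affine_energy excess (indicator (dilate (1/2))) p"
    using excess_energy_coercive[OF bump_dilate[of "1/2"] zero_interior_dilate[of "1/2"]] by auto
  define R where "R = (B + C) / c"
  have bounded: "norm (minimizer r) \<le> R" if r: "1/2 < r" "r < 1" for r
  proof -
    have "c * norm (minimizer r) - C \<le> (1 - r) * B"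
      using c(2)[of "minimizer r"] bound[of "1/2" r] r by simp
    also have "\<dots> \<le> 1 * B"
      using r B by (intro mult_right_mono) auto
    finally show ?thesis
      using c(1) by (simp add: R_def le_divide_eq mult.commute)
  qed
  define Z where "Z = domain \<inter> cball 0 R - U"
  have "compact Z"
    unfolding Z_def using U(1)
    by (intro compact_diff closed_Int_compact closed_Times closed_Sym_pos_SL closed_UNIV compact_cball)
  then have "eventually (\<lambda>r. minimizer r \<notin> Z) (at_left 1)"
  proof (rule eventually_notin_compact)
    fix q assume "q \<in> Z"
    then have q: "q \<in> domain" "q \<noteq> (mat 1, 0)"
      using U(2) by (auto simp: Z_def)
    obtain \<rho> where \<rho>: "0 < \<rho>" "\<rho> < 1" "0 < affine_energy excess (indicator (dilate \<rho>)) q"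
      using excess_energy_pos[OF q] by auto
    let ?G = "affine_energy excess (indicator (dilate \<rho>))"
    let ?O = "{p. ?G q / 2 < ?G p}"
    have "open ?O"
      by (intro open_Collect_less continuous_on_const continuous_on_affine_energy[OF bump_dilate[OF \<rho>(1)] continuous_on_excess])
    moreover have "q \<in> ?O"
      using \<rho>(3) by simp
    moreover have "eventually (\<lambda>r. minimizer r \<notin> ?O) (at_left 1)"
    proof -
      have "((\<lambda>r. (1 - r) * B) \<longlongrightarrow> (1 - 1) * B) (at_left (1::real))"
        by (intro tendsto_intros)
      then have "eventually (\<lambda>r. (1 - r) * B < ?G q / 2) (at_left (1::real))"
        using \<rho>(3) by (intro order_tendstoD(2)) auto
      moreover have "eventually (\<lambda>r. r \<in> {max \<rho> (1/2)<..<1}) (at_left (1::real))"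
        using \<rho>(2) by (intro near) auto
      ultimately show ?thesis
      proof eventually_elim
        case (elim r)
        then show ?case
          using bound[OF \<rho>(1), of r] by auto
      qed
    qed
    ultimately show "\<exists>U. open U \<and> q \<in> U \<and> eventually (\<lambda>r. minimizer r \<notin> U) (at_left 1)"
      by blast
  qed
  moreover have "eventually (\<lambda>r. r \<in> {1/2<..<1}) (at_left (1::real))"
    by (rule near) simp
  ultimately show "eventually (\<lambda>r. minimizer r \<in> U) (at_left 1)"
  proof eventually_elim
    case (elim r)
    then have "minimizer r \<in> domain \<inter> cball 0 R"
      using minimizer(1)[of r] bounded[of r] by auto
    then show ?case
      using elim by (auto simp: Z_def)
  qed
qed

lemma L_functional_eq_energy: "L_functional K f g r p = 1 / (1 - r) * energy r p"
  by (cases p) (simp add: L_functional_def energy_def affine_energy_def weight_def)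

lemma minimizer_L_functional:
  assumes r: "1/2 < r" "r < 1"
  shows "unique_minimum_on (L_functional K f g r) domain (minimizer r)"
proof -
  have iff: "L_functional K f g r p \<le> L_functional K f g r q \<longleftrightarrow> energy r p \<le> energy r q" for p q
    using r by (simp add: L_functional_eq_energy divide_le_cancel)
  show ?thesis
    unfolding unique_minimum_on_iff iff
  proof (intro conjI ballI impI)
    show "minimizer r \<in> domain"
      by (rule minimizer(1)[OF r])
    show "energy r (minimizer r) \<le> energy r z" if "z \<in> domain" for z
      using that by (rule minimizer(2)[OF r])
    show "q = minimizer r" if "q \<in> domain" "\<forall>z\<in>domain. energy r q \<le> energy r z" for q
      using that(1) bspec[OF that(2)] by (rule minimizer(3)[OF r])
  qed
qed

text \<open>Substitute \<open>x \<mapsto> A x + v\<close>, which preserves volume.\<close>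
lemma I_functional_eq_L_functional:
  assumes r: "0 < r" "r < 1" and A: "det A = 1"
  shows "I_functional K f g r ((1 / (1 - r)) *\<^sub>R (A - mat 1), (1 / (1 - r)) *\<^sub>R v) = L_functional K f g r (A, v)"
proof -
  let ?h = "\<lambda>x. rescale r f (norm x) * weight r (matrix_inv A *v (x - v))"
  have inv: "matrix_inv A ** A = mat 1"
  proof -
    have "\<exists>B. A ** B = mat 1 \<and> B ** A = mat 1"
      using A invertible_det_nz[of A] unfolding invertible_def by simp
    then show ?thesis
      unfolding matrix_inv_def by (rule someI2_ex) simp
  qed
  have "continuous_on UNIV (\<lambda>x::real^'n. matrix_inv A *v (x - v))"
    unfolding matrix_vector_mult_diff_distrib by (intro continuous_intros)
  then have "(\<lambda>x. weight r (matrix_inv A *v (x - v))) \<in> borel_measurable borel"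
    using measurable_compose[OF borel_measurable_continuous_onI bump_onD(4)[OF bump_weight[OF r]]] by blast
  moreover have "(\<lambda>x::real^'n. rescale r f (norm x)) \<in> borel_measurable borel"
    by (intro borel_measurable_continuous_onI radial_profile_continuous_norm[OF profile[OF r(2)]])
  ultimately have "(LINT x|lebesgue. ?h (A *v x + v)) = (LINT x|lebesgue. ?h x)"
    by (intro lebesgue_integral_affine_unimodular[OF A] borel_measurable_times)
  then show ?thesis
    using r by (simp add: I_functional_def L_functional_def weight_def matrix_vector_mul_assoc inv)
qed

lemma minimizer_I_functional:
  assumes r: "1/2 < r" "r < 1"
  shows "unique_minimum_on (I_functional K f g r) (rescaled_SL_Sym_pos r \<times> UNIV)
    ((1 / (1 - r)) *\<^sub>R (fst (minimizer r) - mat 1), (1 / (1 - r)) *\<^sub>R snd (minimizer r))"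
proof -
  let ?T = "\<lambda>p :: (real^'n^'n) \<times> (real^'n).
      ((1 / (1 - r)) *\<^sub>R (fst p - mat 1), (1 / (1 - r)) *\<^sub>R snd p)"
  have "unique_minimum_on (I_functional K f g r) (?T ` domain) (?T (minimizer r))"
  proof (rule unique_minimum_on_image[OF minimizer_L_functional[OF r]])
    fix z assume "z \<in> domain"
    then show "I_functional K f g r (?T z) = L_functional K f g r z"
      using I_functional_eq_L_functional[of r "fst z" "snd z"] r by (auto simp: SL_def)
  qed
  moreover have "?T ` domain = rescaled_SL_Sym_pos r \<times> UNIV"
  proof (intro equalityI subsetI)
    fix y :: "(real^'n^'n) \<times> (real^'n)"
    assume "y \<in> rescaled_SL_Sym_pos r \<times> (UNIV :: (real^'n) set)"
    then obtain A w where A: "A \<in> SL" "A \<in> Sym_pos" "y = ((1 / (1 - r)) *\<^sub>R (A - mat 1), w)"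
      by (auto simp: rescaled_SL_Sym_pos_def)
    then have "y = ?T (A, (1 - r) *\<^sub>R w)"
      using r by simp
    then show "y \<in> ?T ` domain"
      using A by blast
  qed (auto simp: rescaled_SL_Sym_pos_def)
  ultimately show ?thesis
    by simp
qed

lemma trace_rescaled_minimizer_tendsto_0:
  "((\<lambda>r. trace ((1 / frobenius_norm ((1 / (1 - r)) *\<^sub>R (fst (minimizer r) - mat 1))) *\<^sub>R
      ((1 / (1 - r)) *\<^sub>R (fst (minimizer r) - mat 1)))) \<longlongrightarrow> 0) (at_left 1)"
proof -
  have lim: "((\<lambda>r. fst (minimizer r)) \<longlongrightarrow> mat 1) (at_left 1)"
    using tendsto_fst[OF minimizer_tendsto] by simp
  have near: "eventually (\<lambda>r. r \<in> {1/2<..<1}) (at_left (1::real))"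
    by (rule eventually_at_left_real) simp
  then have "eventually (\<lambda>r. det (fst (minimizer r)) = 1) (at_left 1)"
  proof eventually_elim
    case (elim r)
    then show ?case
      using minimizer(1)[of r] by (auto simp: SL_def)
  qed
  from trace_normalized_tendsto_0[OF lim this] show ?thesis
  proof (rule Lim_transform_eventually)
    show "eventually (\<lambda>r. trace ((1 / norm (fst (minimizer r) - mat 1)) *\<^sub>R (fst (minimizer r) - mat 1))
        = trace ((1 / frobenius_norm ((1 / (1 - r)) *\<^sub>R (fst (minimizer r) - mat 1))) *\<^sub>R
            ((1 / (1 - r)) *\<^sub>R (fst (minimizer r) - mat 1)))) (at_left 1)"
      using near by eventually_elim (simp add: frobenius_norm_eq_norm)
  qed
qed

end

theorem theorem7:
  fixes K :: "(real^'n) set" and f g :: "real \<Rightarrow> real"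
  assumes "convex_body K" and "loewner_position K"
    and "locally_lipschitz f" and "convex_on UNIV f"
    and "\<forall>x\<le>-1. f x = 0" and "strict_mono_on {-1..} f"
    and "locally_lipschitz g" and "antimono g"
    and "\<forall>x\<le>-1. g x = 1" and "\<forall>x\<in>{-1<..<1}. 0 < g x" and "\<forall>x\<ge>1. g x = 0"
  shows "\<exists>(A :: real \<Rightarrow> real^'n^'n) (v :: real \<Rightarrow> real^'n)
            (M :: real \<Rightarrow> real^'n^'n) (w :: real \<Rightarrow> real^'n).
     (\<forall>r\<in>{1/2<..<1}.
        unique_minimum_on (L_functional K f g r) ((Sym_pos \<inter> SL) \<times> UNIV) (A r, v r)) \<and>
     ((\<lambda>r. (A r, v r)) \<longlongrightarrow> (mat 1, 0)) (at_left 1) \<and>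
     (\<forall>r\<in>{1/2<..<1}.
        M r = (1 / (1 - r)) *\<^sub>R (A r - mat 1) \<and> w r = (1 / (1 - r)) *\<^sub>R v r \<and>
        unique_minimum_on (I_functional K f g r) (rescaled_SL_Sym_pos r \<times> UNIV) (M r, w r)) \<and>
     ((\<lambda>r. trace ((1 / frobenius_norm (M r)) *\<^sub>R M r)) \<longlongrightarrow> 0) (at_left 1)"
proof -
  interpret loewner_body K f g
    using assms by unfold_locales
  show ?thesis
    using minimizer_L_functional minimizer_tendsto minimizer_I_functional trace_rescaled_minimizer_tendsto_0
    by (intro exI[of _ "\<lambda>r. fst (minimizer r)"] exI[of _ "\<lambda>r. snd (minimizer r)"]
        exI[of _ "\<lambda>r. (1 / (1 - r)) *\<^sub>R (fst (minimizer r) - mat 1)"]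
        exI[of _ "\<lambda>r. (1 / (1 - r)) *\<^sub>R snd (minimizer r)"]) simp
qed

end
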